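(* Let $n\ge2$, let $\Omega$ be a bounded domain of $\mathbb{H}^n$, let $H\in C^1(\mathcal{C}_{\overline\Omega})$, let $r_1,r_2\in\mathbb{R}$ be such that $r_1\ne r_2$ and $0<r_1\le1\le r_2$, and let $\nu_0>0$. Then there exists a constant $C=C(r_1,r_2,\nu_0,\Omega,H)>0$ such that for every $t\in[0,1]$ and every solution $u\in C^3(\overline\Omega)$ of $$\begin{cases}\displaystyle-\mathrm{div}_{\mathbb{H}^n}\Big(\frac{\nabla u}{\sqrt{1-|\nabla u|^2}}\Big)+\frac{nt}{\sqrt{1-|\nabla u|^2}}=nt\,e^uH(e^uq)&\text{in }\Omega,\\ |\nabla u|<1&\text{in }\Omega,\\ u=0&\text{on }\partial\Omega,\end{cases}$$ satisfying $\log r_1\le u\le\log r_2$ and $\sup_{\partial\Omega}\nu\le\nu_0$, where $\nu:=\frac{1}{\sqrt{1-|\nabla u|^2}}$, one has $$\sup_\Omega\nu\le C.$$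
   Context: The Lorentz-Minkowski space $\mathbb{L}^{n+1}$ is $\mathbb{R}^{n+1}$ with the bilinear form $\langle x,y\rangle=x_1y_1+\dots+x_ny_n-x_{n+1}y_{n+1}$. The hyperbolic space is $\mathbb{H}^n=\{x\in\mathbb{L}^{n+1}:\langle x,x\rangle=-1,\ x_{n+1}>0\}$, with the Riemannian metric $g$ induced by $\langle\cdot,\cdot\rangle$. $\nabla u$ and $\mathrm{div}_{\mathbb{H}^n}$ are the gradient and divergence of $(\mathbb{H}^n,g)$, and $|\nabla u|$ is the $g$-norm. $\mathcal{C}_{\overline\Omega}:=\{\rho q:\ q\in\overline\Omega,\ \rho>0\}$; $q$ denotes the variable point of $\Omega\subset\mathbb{H}^n\subset\mathbb{R}^{n+1}$. *)

theory Defs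
  imports "HOL-Analysis.Analysis"
begin

text \<open>A point of \<open>\<real>\<^sup>n\<^sup>+\<^sup>1\<close> is a pair consisting of its first \<open>n = CARD('n)\<close> coordinates and its
  last (timelike) coordinate. The topology is the Euclidean one.\<close>

type_synonym 'n mink = "(real ^ 'n) \<times> real"

definition lorentz :: "('n::finite) mink \<Rightarrow> 'n mink \<Rightarrow> real" where
  "lorentz x y = fst x \<bullet> fst y - snd x * snd y"

definition hyp_space :: "('n::finite) mink set" where
  "hyp_space = {x. lorentz x x = -1 \<and> snd x > 0}"

definition hyp_tangent :: "('n::finite) mink \<Rightarrow> 'n mink set" where
  "hyp_tangent q = {v. lorentz q v = 0}"

text \<open>The norm of the induced metric; meant for vectors tangent to \<open>hyp_space\<close>, on which
  \<open>lorentz\<close> is positive definite.\<close>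

definition hyp_norm :: "('n::finite) mink \<Rightarrow> real" where
  "hyp_norm v = sqrt (lorentz v v)"

text \<open>The geodesic distance of the hyperboloid model.\<close>

definition hyp_dist :: "('n::finite) mink \<Rightarrow> 'n mink \<Rightarrow> real" where
  "hyp_dist p q = arcosh (- lorentz p q)"

definition hyp_bounded :: "('n::finite) mink set \<Rightarrow> bool" where
  "hyp_bounded S \<longleftrightarrow> (\<exists>R. \<forall>p\<in>S. \<forall>q\<in>S. hyp_dist p q \<le> R)"

definition hyp_domain :: "('n::finite) mink set \<Rightarrow> bool" where
  "hyp_domain \<Omega> \<longleftrightarrow> \<Omega> \<noteq> {} \<and> openin (top_of_set hyp_space) \<Omega> \<and> connected \<Omega>"

abbreviation hyp_closure :: "('n::finite) mink set \<Rightarrow> 'n mink set" where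
  "hyp_closure \<Omega> \<equiv> top_of_set hyp_space closure_of \<Omega>"

abbreviation hyp_boundary :: "('n::finite) mink set \<Rightarrow> 'n mink set" where
  "hyp_boundary \<Omega> \<equiv> top_of_set hyp_space frontier_of \<Omega>"

definition open_ray_cone :: "('n::finite) mink set \<Rightarrow> 'n mink set" where
  "open_ray_cone S = {\<rho> *\<^sub>R q | \<rho> q. q \<in> S \<and> \<rho> > 0}"

text \<open>The gradient at \<open>q\<close> is the tangent vector representing the differential of \<open>u\<close> with
  respect to the metric. The derivative within the hypersurface determines a linear form only on
  the tangent space at \<open>q\<close>, so the requirement that \<open>w\<close> be tangent makes it unique.\<close>

definition hyp_grad :: "(('n::finite) mink \<Rightarrow> real) \<Rightarrow> 'n mink \<Rightarrow> 'n mink" where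
  "hyp_grad u q =
     (THE w. w \<in> hyp_tangent q \<and> (u has_derivative (\<lambda>v. lorentz w v)) (at q within hyp_space))"

text \<open>The Levi-Civita connection of the induced metric is the tangential part of the flat
  connection of the ambient space; since \<open>lorentz q q = -1\<close>, the tangential part of \<open>w\<close> at \<open>q\<close>
  is \<open>w + lorentz w q *\<^sub>R q\<close>. Used for \<open>v \<in> hyp_tangent q\<close> only, where the
  derivative within \<open>hyp_space\<close> is unambiguous.\<close>

definition hyp_tangential :: "('n::finite) mink \<Rightarrow> 'n mink \<Rightarrow> 'n mink" where
  "hyp_tangential q w = w + lorentz w q *\<^sub>R q"

definition hyp_cov :: "(('n::finite) mink \<Rightarrow> 'n mink) \<Rightarrow> 'n mink \<Rightarrow> 'n mink \<Rightarrow> 'n mink" where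
  "hyp_cov X q v = hyp_tangential q (frechet_derivative X (at q within hyp_space) v)"

definition hyp_frame :: "('n::finite) mink \<Rightarrow> 'n mink set \<Rightarrow> bool" where
  "hyp_frame q E \<longleftrightarrow> E \<subseteq> hyp_tangent q \<and> finite E \<and> card E = CARD('n) \<and>
     (\<forall>e\<in>E. \<forall>f\<in>E. lorentz e f = (if e = f then 1 else 0))"

text \<open>The divergence is the trace of \<open>v \<mapsto> \<nabla>\<^sub>v X\<close> on the tangent space; the choice of the
  orthonormal frame is immaterial.\<close>

definition hyp_div :: "(('n::finite) mink \<Rightarrow> 'n mink) \<Rightarrow> 'n mink \<Rightarrow> real" where
  "hyp_div X q = (\<Sum>e\<in>(SOME E. hyp_frame q E). lorentz (hyp_cov X q e) e)"

text \<open>For open \<open>U\<close> and \<open>U \<subseteq> D \<subseteq> closure U\<close>: \<open>f\<close> is of class \<open>C\<^sup>k\<close> in \<open>U\<close> and all its partial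
  derivatives of order at most \<open>k\<close> extend continuously to \<open>D\<close>.\<close>

primrec Ck_ext ::
  "nat \<Rightarrow> 'a::euclidean_space set \<Rightarrow> 'a set \<Rightarrow> ('a \<Rightarrow> real) \<Rightarrow> bool" where
  "Ck_ext 0 U D f \<longleftrightarrow> (\<exists>F. continuous_on D F \<and> (\<forall>x\<in>U. F x = f x))"
| "Ck_ext (Suc k) U D f \<longleftrightarrow>
     (\<exists>F. continuous_on D F \<and> (\<forall>x\<in>U. F x = f x)) \<and>
     (\<forall>x\<in>U. f differentiable (at x)) \<and>
     (\<forall>b\<in>Basis. Ck_ext k U D (\<lambda>x. frechet_derivative f (at x) b))"

text \<open>Inverse of the global chart \<open>fst\<close> of \<open>hyp_space\<close>.\<close>

definition hyp_param :: "real ^ ('n::finite) \<Rightarrow> 'n mink" where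
  "hyp_param y = (y, sqrt (1 + y \<bullet> y))"

text \<open>The class \<open>C\<^sup>k\<close> on the closure of a domain: continuity up to the boundary is required of the
  given function itself, not only of some extension of its restriction to the open set.\<close>

definition hyp_Ck_closure :: "nat \<Rightarrow> ('n::finite) mink set \<Rightarrow> ('n mink \<Rightarrow> real) \<Rightarrow> bool" where
  "hyp_Ck_closure k \<Omega> u \<longleftrightarrow> continuous_on (hyp_closure \<Omega>) u \<and>
     Ck_ext k (fst ` \<Omega>) (fst ` hyp_closure \<Omega>) (\<lambda>y. u (hyp_param y))"

definition cone_Ck_closure :: "nat \<Rightarrow> ('n::finite) mink set \<Rightarrow> ('n mink \<Rightarrow> real) \<Rightarrow> bool" where
  "cone_Ck_closure k \<Omega> H \<longleftrightarrow> continuous_on (open_ray_cone (hyp_closure \<Omega>)) H \<and>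
     Ck_ext k (open_ray_cone \<Omega>) (open_ray_cone (hyp_closure \<Omega>)) H"

text \<open>The gradient on the closure of \<open>\<Omega>\<close>; at boundary points it is the continuous extension
  of the gradient from \<open>\<Omega>\<close>.\<close>

definition hyp_grad_closure ::
  "('n::finite) mink set \<Rightarrow> ('n mink \<Rightarrow> real) \<Rightarrow> 'n mink \<Rightarrow> 'n mink" where
  "hyp_grad_closure \<Omega> u q =
     (if q \<in> \<Omega> then hyp_grad u q else Lim (at q within \<Omega>) (hyp_grad u))"

text \<open>Extended-valued, so that \<open>nu\<close> is \<open>\<infinity>\<close> where the gradient has norm 1 (possible on
  the boundary); with real division it would be 0 there.\<close>

definition nu :: "('n::finite) mink set \<Rightarrow> ('n mink \<Rightarrow> real) \<Rightarrow> 'n mink \<Rightarrow> ennreal" where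
  "nu \<Omega> u q = 1 / ennreal (sqrt (1 - (hyp_norm (hyp_grad_closure \<Omega> u q))\<^sup>2))"

definition solves_dirichlet ::
  "('n::finite) mink set \<Rightarrow> ('n mink \<Rightarrow> real) \<Rightarrow> real \<Rightarrow> ('n mink \<Rightarrow> real) \<Rightarrow> bool" where
  "solves_dirichlet \<Omega> H t u \<longleftrightarrow>
     (\<forall>q\<in>\<Omega>.
        - hyp_div (\<lambda>p. (1 / sqrt (1 - (hyp_norm (hyp_grad u p))\<^sup>2)) *\<^sub>R hyp_grad u p) q
        + real CARD('n) * t / sqrt (1 - (hyp_norm (hyp_grad u q))\<^sup>2)
        = real CARD('n) * t * exp (u q) * H (exp (u q) *\<^sub>R q)) \<and>
     (\<forall>q\<in>\<Omega>. hyp_norm (hyp_grad u q) < 1) \<and>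
     (\<forall>q\<in>hyp_boundary \<Omega>. u q = 0)"

end

(* The solution u is extended to a function U on the cone over \<Omega> that is homogeneous of degree 0,
   so that all computations take place in the flat space R^(n+1) with the constant Lorentz form.
   Put P = - <x,x> <DU,DU>, which is |grad u|^2 on \<Omega>, and consider the minimum over the compact
   closure of \<Omega> of (1 - P) exp (- n u^2). If it is attained on the boundary, it is controlled by
   \<nu>0. If it is attained at an interior point q, then with m its value P + m exp (n U^2) has a
   local maximum at q; its Hessian is contracted with (1 - P) times the inverse metric plus
   grad u (x) grad u, which is the coefficient matrix of the equation, and the third derivatives
   are eliminated by differentiating the equation in the direction of grad u. The commutator
   (Bochner) term - 2 (n - 1) P caused by the negative curvature is compensated by the second
   derivative 2 n of n u^2, the terms of order 1 - P containing H and t cancel, and what remains is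
   P <= K sqrt (1 - P). *)

theory Submission
  imports Defs
begin

section \<open>The Lorentz form\<close>

text \<open>The weight \<open>exp (- n u^2)\<close> is multiplicative so that at an interior minimum
  the differential of \<open>P\<close> is itself a multiple of \<open>1 - P\<close>; differentiating
  the equation, whose right-hand side is of order \<open>1 - P\<close> once denominators are
  cleared, then creates no term of lower order. A weight linear in u in the exponent would
  contribute only at order \<open>(1 - P)^2\<close>, too weak against the curvature term; the
  convexity of \<open>n u^2\<close> contributes at order \<open>1 - P\<close>, and the factor n
  leaves the margin \<open>2 (1 - P) P\<close>. Homogeneity serves twice. It makes \<open>P\<close>
  constant along rays, so a maximum relative to the hypersurface is one on an open cone and the
  ordinary second derivative test applies. And since derivatives commute in flat space, the
  curvature enters only through the Euler relations \<open>A x x = - gr x\<close> and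
  \<open>B x w x = - 2 *\<^sub>R A x w\<close>. Third derivatives are used only inside the domain;
  on the boundary the gradient need only be a continuous extension, which is what compactness
  requires.\<close>

lemma lorentz_bilinear: "bounded_bilinear lorentz"
proof -
  have "bounded_bilinear (\<lambda>x y :: 'a mink. fst x \<bullet> fst y - snd x * snd y)"
    unfolding bilinear_conv_bounded_bilinear[symmetric]
    by (auto simp: bilinear_def linear_iff inner_add_left inner_add_right algebra_simps)
  then show ?thesis
    by (simp add: lorentz_def[abs_def])
qed

interpretation lorentz: bounded_bilinear lorentz
  by (rule lorentz_bilinear)

lemma lorentz_commute: "lorentz x y = lorentz y x"
  by (simp add: lorentz_def inner_commute mult.commute)

text \<open>The Gram matrix of the Lorentz form, which is its own inverse. It converts the form into
  the Euclidean inner product and back, and it maps the standard basis to the basis dual to it with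
  respect to \<open>lorentz\<close>.\<close>

definition flip_time :: "('n::finite) mink \<Rightarrow> 'n mink" where
  "flip_time x = (fst x, - snd x)"

lemma flip_time_linear: "linear flip_time"
  by (rule linearI) (auto simp: flip_time_def prod_eq_iff)

lemma flip_time_flip_time [simp]: "flip_time (flip_time x) = x"
  by (simp add: flip_time_def)

lemma lorentz_flip_time: "lorentz (flip_time x) y = x \<bullet> y" "lorentz x (flip_time y) = x \<bullet> y"
  by (simp_all add: lorentz_def flip_time_def inner_prod_def)

lemma lorentz_eq_inner: "lorentz x y = flip_time x \<bullet> y" "lorentz x y = x \<bullet> flip_time y"
  by (simp_all add: lorentz_def flip_time_def inner_prod_def)

lemma lorentz_nondegenerate:
  assumes "\<And>v. lorentz w v = 0"
  shows "w = 0"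
  using assms[of "flip_time w"] by (simp add: lorentz_flip_time)

lemma flip_time_expansion: "(\<Sum>b\<in>Basis. lorentz v b *\<^sub>R flip_time b) = v"
proof -
  have "v = flip_time (flip_time v)"
    by simp
  also have "\<dots> = flip_time (\<Sum>b\<in>Basis. (flip_time v \<bullet> b) *\<^sub>R b)"
    by (simp only: euclidean_representation)
  also have "\<dots> = (\<Sum>b\<in>Basis. (flip_time v \<bullet> b) *\<^sub>R flip_time b)"
    by (simp add: linear_sum[OF flip_time_linear] linear_cmul[OF flip_time_linear])
  finally show ?thesis
    by (simp add: lorentz_eq_inner)
qed

text \<open>Contraction with the inverse Lorentz metric: \<open>b\<close> and
  \<open>flip_time b\<close> run through dual bases.\<close>

definition bilin_trace :: "(('n::finite) mink \<Rightarrow> 'n mink \<Rightarrow> real) \<Rightarrow> real" where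
  "bilin_trace M = (\<Sum>b\<in>Basis. M b (flip_time b))"

lemma flip_time_Basis: "b \<in> Basis \<Longrightarrow> flip_time b = lorentz b b *\<^sub>R b"
  by (auto simp: Basis_prod_def flip_time_def lorentz_def Basis_vec_def inner_axis_axis)

lemma bilin_trace_flip:
  assumes "bilinear M"
  shows "bilin_trace M = (\<Sum>b\<in>Basis. M (flip_time b) b)"
  unfolding bilin_trace_def
  using assms by (intro sum.cong refl) (simp add: flip_time_Basis bilinear_lmul bilinear_rmul)

text \<open>A frame together with \<open>q\<close> is orthonormal for a form of signature (n,1),
  hence independent, and its n + 1 members span. The difference of both sides is orthogonal to all
  of them, so nondegeneracy makes it zero. The minus sign reflects that \<open>q\<close> is
  timelike.\<close>

lemma hyp_frame_expansion:
  assumes q: "lorentz q q = -1" and E: "hyp_frame q E"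
  shows "v = (\<Sum>e\<in>E. lorentz v e *\<^sub>R e) - lorentz v q *\<^sub>R (q :: ('n::finite) mink)"
proof -
  have fin: "finite E" and card: "card E = CARD('n)"
    and ort: "\<And>e f. e \<in> E \<Longrightarrow> f \<in> E \<Longrightarrow> lorentz e f = (if e = f then 1 else 0)"
    and tang: "\<And>e. e \<in> E \<Longrightarrow> lorentz q e = 0" "\<And>e. e \<in> E \<Longrightarrow> lorentz e q = 0"
    using E by (auto simp: hyp_frame_def hyp_tangent_def lorentz_commute)
  have qE: "q \<notin> E"
    using q ort[of q q] by auto
  have proj: "lorentz (\<Sum>e\<in>E. c e *\<^sub>R e) f = c f" if "f \<in> E" for c f
  proof -
    have "lorentz (\<Sum>e\<in>E. c e *\<^sub>R e) f = (\<Sum>e\<in>E. if e = f then c e else 0)"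
      by (simp add: lorentz.sum_left lorentz.scaleR_left ort that cong: sum.cong)
         (intro sum.cong, auto)
    then show ?thesis
      using fin that by simp
  qed
  have projq: "lorentz (\<Sum>e\<in>E. c e *\<^sub>R e) q = 0" for c
    by (simp add: lorentz.sum_left lorentz.scaleR_left tang)
  have indep: "independent (insert q E)"
    unfolding independent_explicit
  proof (intro conjI allI impI)
    show "finite (insert q E)"
      using fin by simp
    fix c assume "(\<Sum>v\<in>insert q E. c v *\<^sub>R v) = 0"
    then have *: "c q *\<^sub>R q + (\<Sum>v\<in>E. c v *\<^sub>R v) = 0"
      using fin qE by simp
    have "lorentz (c q *\<^sub>R q + (\<Sum>v\<in>E. c v *\<^sub>R v)) q = - c q"
      by (simp add: lorentz.add_left lorentz.scaleR_left projq q)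
    then have "c q = 0"
      by (simp add: * lorentz.zero_left)
    moreover have "c e = 0" if "e \<in> E" for e
    proof -
      have "lorentz (c q *\<^sub>R q + (\<Sum>v\<in>E. c v *\<^sub>R v)) e = c e"
        by (simp add: lorentz.add_left lorentz.scaleR_left proj tang that)
      then show ?thesis
        by (simp add: * lorentz.zero_left)
    qed
    ultimately show "\<forall>v\<in>insert q E. c v = 0"
      by blast
  qed
  have "card (insert q E) = DIM('n mink)"
    using fin qE card by simp
  then have span: "UNIV \<subseteq> span (insert q E)"
    by (intro card_ge_dim_independent[OF _ indep]) (auto simp: dim_UNIV)
  define w where "w = v - ((\<Sum>e\<in>E. lorentz v e *\<^sub>R e) - lorentz v q *\<^sub>R q)"
  have w0: "lorentz w x = 0" if "x \<in> insert q E" for x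
    using that q
    by (auto simp: w_def lorentz.diff_left lorentz.scaleR_left proj projq tang)
  have "lorentz w x = 0" for x
  proof -
    have "x \<in> span (insert q E)"
      using span by auto
    then show ?thesis
      by (induction rule: span_induct_alt)
         (auto simp: lorentz.zero_right lorentz.add_right lorentz.scaleR_right w0)
  qed
  then have "w = 0"
    by (rule lorentz_nondegenerate)
  then show ?thesis
    by (simp add: w_def algebra_simps)
qed

text \<open>The ambient trace counts the timelike unit vector \<open>q\<close> with sign -1, so
  adding \<open>M q q\<close> leaves the trace over the tangent space. Tangential traces thus become
  frame-free ambient ones.\<close>

lemma hyp_frame_trace:
  assumes q: "lorentz q q = -1" and E: "hyp_frame q E" and M: "bilinear M"
  shows "(\<Sum>e\<in>E. M e e) = bilin_trace M + M q q"
proof -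
  note [simp] = bilinear_radd[OF M] bilinear_rsub[OF M] bilinear_rmul[OF M]
    bilinear_ladd[OF M] bilinear_lmul[OF M]
  have lin: "linear (M v)" "linear (\<lambda>w. M w v)" for v
    using M unfolding bilinear_def by blast+
  have flipsum: "(\<Sum>b\<in>Basis. lorentz b v * M (flip_time b) v) = M v v" for v
  proof -
    have "(\<Sum>b\<in>Basis. lorentz b v * M (flip_time b) v) = M (\<Sum>b\<in>Basis. lorentz v b *\<^sub>R flip_time b) v"
      by (simp add: linear_sum[OF lin(2)] lorentz_commute)
    then show ?thesis
      by (simp only: flip_time_expansion)
  qed
  have "bilin_trace M = (\<Sum>b\<in>Basis. M (flip_time b) ((\<Sum>e\<in>E. lorentz b e *\<^sub>R e) - lorentz b q *\<^sub>R q))"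
    unfolding bilin_trace_flip[OF M]
    by (intro sum.cong refl arg_cong2[where f = M] hyp_frame_expansion[OF q E])
  also have "\<dots> = (\<Sum>b\<in>Basis. (\<Sum>e\<in>E. lorentz b e * M (flip_time b) e) - lorentz b q * M (flip_time b) q)"
    by (simp add: linear_sum[OF lin(1)])
  also have "\<dots> = (\<Sum>e\<in>E. \<Sum>b\<in>Basis. lorentz b e * M (flip_time b) e) - M q q"
    unfolding sum_subtractf flipsum[of q] by (subst sum.swap) simp
  also have "\<dots> = (\<Sum>e\<in>E. M e e) - M q q"
    by (simp only: flipsum)
  finally show ?thesis
    by simp
qed

lemma hyp_frame_exists:
  assumes "q \<in> (hyp_space :: ('n::finite) mink set)"
  shows "\<exists>E. hyp_frame q E"
proof -
  define y \<tau> where "y = fst q" and "\<tau> = snd q"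
  have \<tau>: "\<tau> > 0" "\<tau> * \<tau> = 1 + y \<bullet> y"
    using assms by (auto simp: hyp_space_def lorentz_def y_def \<tau>_def)
  \<comment> \<open>the image of the standard frame under the boost that moves \<open>(0, 1)\<close> to \<open>q\<close>\<close>
  define F :: "real^'n \<Rightarrow> 'n mink" where "F v = (v + ((y \<bullet> v) / (1 + \<tau>)) *\<^sub>R y, y \<bullet> v)" for v
  have F: "lorentz (F v) (F w) = v \<bullet> w" for v w
  proof -
    define k where "k = inverse (1 + \<tau>)"
    have k: "k * (1 + \<tau>) = 1"
      using \<tau> by (simp add: k_def)
    have yy: "y \<bullet> y = \<tau> * \<tau> - 1"
      using \<tau> by simp
    \<comment> \<open>The coefficient of \<open>(y \<bullet> v) * (y \<bullet> w)\<close> must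
      vanish; the identity exhibits it as a multiple of \<open>k * (1 + \<tau>) - 1\<close>.\<close>
    have "2 * k + k * k * (\<tau> * \<tau> - 1) = 1 + (k * (1 + \<tau>) - 1) * (1 + k * (\<tau> - 1))"
      by (simp add: algebra_simps)
    then have z: "2 * k + k * k * (y \<bullet> y) - 1 = 0"
      by (simp add: yy k)
    have "lorentz (F v) (F w) = v \<bullet> w + (y \<bullet> v) * (y \<bullet> w) * (2 * k + k * k * (y \<bullet> y) - 1)"
      unfolding F_def lorentz_def divide_inverse k_def[symmetric]
      by (simp add: inner_commute algebra_simps inner_add_left inner_add_right)
    with z show ?thesis by simp
  qed
  have tang: "lorentz q (F v) = 0" for v
  proof -
    have "lorentz q (F v) = (y \<bullet> v) * (1 + (y \<bullet> y) / (1 + \<tau>) - \<tau>)"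
      by (simp add: F_def lorentz_def y_def[symmetric] \<tau>_def[symmetric] inner_add_right algebra_simps)
    moreover have "1 + (y \<bullet> y) / (1 + \<tau>) - \<tau> = 0"
      using \<tau> by (simp add: field_simps)
    ultimately show ?thesis by simp
  qed
  have inj: "inj_on F Basis"
  proof (rule inj_onI)
    fix b c assume bc: "b \<in> Basis" "c \<in> Basis" "F b = F c"
    then have "b \<bullet> b = b \<bullet> c"
      using F by metis
    then show "b = c"
      using bc by (auto simp: inner_Basis split: if_splits)
  qed
  have "hyp_frame q (F ` Basis)"
    unfolding hyp_frame_def
  proof (intro conjI ballI)
    show "card (F ` Basis) = CARD('n)"
      using inj by (simp add: card_image)
    fix e f assume "e \<in> F ` Basis" "f \<in> F ` Basis"
    then obtain b c where "b \<in> Basis" "c \<in> Basis" "e = F b" "f = F c"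
      by blast
    then show "lorentz e f = (if e = f then 1 else 0)"
      using F inj by (auto simp: inner_Basis inj_on_def)
  qed (auto simp: hyp_tangent_def tang)
  then show ?thesis by blast
qed

lemma bilin_trace_nonpos:
  assumes "q \<in> hyp_space" "bilinear M" "\<And>v. M v v \<le> 0"
  shows "bilin_trace M + M q q \<le> 0"
proof -
  obtain E where "hyp_frame q E"
    using hyp_frame_exists[OF assms(1)] by blast
  then have "bilin_trace M + M q q = (\<Sum>e\<in>E. M e e)"
    using assms by (intro hyp_frame_trace[symmetric]) (auto simp: hyp_space_def)
  also have "\<dots> \<le> 0"
    using assms by (intro sum_nonpos) auto
  finally show ?thesis .
qed

definition op_trace :: "(('n::finite) mink \<Rightarrow> 'n mink) \<Rightarrow> real" where
  "op_trace L = (\<Sum>b\<in>Basis. lorentz (L b) (flip_time b))"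

text \<open>On the tangent space of a point \<open>q\<close> of the hyperboloid the form is positive definite, so
  the trace of the square of \<open>A\<close> can be negative only through the terms involving \<open>q\<close>.\<close>

lemma op_trace_square_ge:
  assumes q: "q \<in> hyp_space" and A: "linear A"
    and sym: "\<And>v w. lorentz (A v) w = lorentz v (A w)"
  shows "op_trace (\<lambda>v. A (A v)) \<ge> - 2 * lorentz (A q) (A q) - lorentz (A q) q ^ 2"
proof -
  have qq: "lorentz q q = -1"
    using q by (auto simp: hyp_space_def)
  obtain E where E: "hyp_frame q E"
    using hyp_frame_exists[OF q] by blast
  have fr: "lorentz (A v) (A v) = (\<Sum>e\<in>E. lorentz (A v) e ^ 2) - lorentz (A v) q ^ 2" for v
  proof -
    have "lorentz (A v) (A v) = lorentz (A v) ((\<Sum>e\<in>E. lorentz (A v) e *\<^sub>R e) - lorentz (A v) q *\<^sub>R q)"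
      by (intro arg_cong2[where f = lorentz] refl hyp_frame_expansion[OF qq E])
    then show ?thesis
      by (simp add: lorentz.diff_right lorentz.sum_right lorentz.scaleR_right power2_eq_square)
  qed
  define M where "M v w = lorentz (A v) (A w)" for v w
  have M: "bilinear M"
    using A by (auto simp: bilinear_def M_def linear_iff lorentz.add_left lorentz.add_right lorentz.scaleR_left lorentz.scaleR_right)
  have "op_trace (\<lambda>v. A (A v)) = bilin_trace M"
    by (simp add: op_trace_def bilin_trace_def M_def sym)
  also have "\<dots> = (\<Sum>e\<in>E. lorentz (A e) (A e)) - lorentz (A q) (A q)"
    using hyp_frame_trace[OF qq E M] by (simp add: M_def)
  also have "(\<Sum>e\<in>E. lorentz (A e) (A e)) = (\<Sum>e\<in>E. \<Sum>f\<in>E. lorentz (A e) f ^ 2) - (\<Sum>e\<in>E. lorentz (A e) q ^ 2)"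
    by (simp add: fr sum_subtractf)
  \<comment> \<open>By symmetry the entries \<open>lorentz (A e) q\<close> are the frame components
    of \<open>A q\<close>, so \<open>fr\<close> at \<open>q\<close> evaluates their sum of
    squares.\<close>
  also have "(\<Sum>e\<in>E. lorentz (A e) q ^ 2) = lorentz (A q) (A q) + lorentz (A q) q ^ 2"
    using fr[of q] sym by (simp add: lorentz_commute)
  finally have *: "op_trace (\<lambda>v. A (A v)) = (\<Sum>e\<in>E. \<Sum>f\<in>E. lorentz (A e) f ^ 2)
      - (lorentz (A q) (A q) + lorentz (A q) q ^ 2) - lorentz (A q) (A q)" .
  \<comment> \<open>This is the squared norm of the tangential block of \<open>A\<close>; only its
    sign is used.\<close>
  have "0 \<le> (\<Sum>e\<in>E. \<Sum>f\<in>E. lorentz (A e) f ^ 2)"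
    by (intro sum_nonneg) auto
  with * show ?thesis by linarith
qed

section \<open>Functions of class \<open>C\<^sup>k\<close>\<close>

text \<open>Interior counterpart of \<open>Ck_ext\<close>. The derivative is existentially
  quantified and taken in all directions, so that closure under products and composition can be
  shown by exhibiting explicit derivatives.\<close>

primrec Ck_on :: "nat \<Rightarrow> 'a::euclidean_space set \<Rightarrow> ('a \<Rightarrow> real) \<Rightarrow> bool" where
  "Ck_on 0 S f \<longleftrightarrow> continuous_on S f"
| "Ck_on (Suc k) S f \<longleftrightarrow>
     (\<exists>f'. (\<forall>x\<in>S. (f has_derivative f' x) (at x)) \<and> (\<forall>v. Ck_on k S (\<lambda>x. f' x v)))"

lemma Ck_on_SucE:
  assumes "Ck_on (Suc k) S f"
  obtains f' where "\<And>x. x \<in> S \<Longrightarrow> (f has_derivative f' x) (at x)" "\<And>v. Ck_on k S (\<lambda>x. f' x v)"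
  using assms by auto

lemma Ck_on_SucI:
  assumes "\<And>x. x \<in> S \<Longrightarrow> (f has_derivative f' x) (at x)" "\<And>v. Ck_on k S (\<lambda>x. f' x v)"
  shows "Ck_on (Suc k) S f"
  using assms by auto

lemma Ck_on_Suc_imp: "Ck_on (Suc k) S f \<Longrightarrow> Ck_on k S f"
proof (induction k arbitrary: f)
  case 0
  then obtain f' where "\<And>x. x \<in> S \<Longrightarrow> (f has_derivative f' x) (at x)"
    by (rule Ck_on_SucE) blast
  then show ?case
    by (auto intro!: continuous_at_imp_continuous_on has_derivative_continuous)
next
  case (Suc k)
  then show ?case
    by (metis Ck_on_SucE Ck_on_SucI)
qed

lemma Ck_on_cong:
  assumes "open S" "\<And>x. x \<in> S \<Longrightarrow> f x = g x" "Ck_on k S f"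
  shows "Ck_on k S g"
proof (cases k)
  case 0
  then show ?thesis
    using assms by (simp cong: continuous_on_cong)
next
  case (Suc k')
  then obtain f' where f': "\<And>x. x \<in> S \<Longrightarrow> (f has_derivative f' x) (at x)"
      "\<And>v. Ck_on k' S (\<lambda>x. f' x v)"
    using assms(3) by (metis Ck_on_SucE)
  have "(g has_derivative f' x) (at x)" if "x \<in> S" for x
    using has_derivative_transform_within_open[OF f'(1) \<open>open S\<close>] that assms(2) by blast
  with f'(2) show ?thesis
    unfolding Suc by (blast intro: Ck_on_SucI)
qed

lemma Ck_on_const: "Ck_on k S (\<lambda>x. c)"
proof (induction k arbitrary: c)
  case (Suc k)
  show ?case
    by (rule Ck_on_SucI[where f' = "\<lambda>x v. 0"]) (use Suc in auto)
qed auto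

lemma Ck_on_linear: "bounded_linear f \<Longrightarrow> Ck_on k S f"
proof (cases k)
  case (Suc k')
  assume "bounded_linear f"
  then show ?thesis
    unfolding Suc
    by (intro Ck_on_SucI[where f' = "\<lambda>x. f"] bounded_linear_imp_has_derivative Ck_on_const)
qed (auto intro: linear_continuous_on)

lemma Ck_on_add:
  "Ck_on k S f \<Longrightarrow> Ck_on k S g \<Longrightarrow> Ck_on k S (\<lambda>x. f x + g x)"
proof (induction k arbitrary: f g)
  case (Suc k)
  obtain f' where f': "\<And>x. x \<in> S \<Longrightarrow> (f has_derivative f' x) (at x)" "\<And>v. Ck_on k S (\<lambda>x. f' x v)"
    using Suc.prems(1) by (rule Ck_on_SucE) blast
  obtain g' where g': "\<And>x. x \<in> S \<Longrightarrow> (g has_derivative g' x) (at x)" "\<And>v. Ck_on k S (\<lambda>x. g' x v)"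
    using Suc.prems(2) by (rule Ck_on_SucE) blast
  show ?case
    by (rule Ck_on_SucI[where f' = "\<lambda>x v. f' x v + g' x v"])
       (auto intro: has_derivative_add f' g' Suc.IH)
qed (auto intro: continuous_on_add)

lemma Ck_on_mult:
  "Ck_on k S f \<Longrightarrow> Ck_on k S g \<Longrightarrow> Ck_on k S (\<lambda>x. f x * g x)"
proof (induction k arbitrary: f g)
  case (Suc k)
  obtain f' where f': "\<And>x. x \<in> S \<Longrightarrow> (f has_derivative f' x) (at x)" "\<And>v. Ck_on k S (\<lambda>x. f' x v)"
    using Suc.prems(1) by (rule Ck_on_SucE) blast
  obtain g' where g': "\<And>x. x \<in> S \<Longrightarrow> (g has_derivative g' x) (at x)" "\<And>v. Ck_on k S (\<lambda>x. g' x v)"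
    using Suc.prems(2) by (rule Ck_on_SucE) blast
  show ?case
  proof (rule Ck_on_SucI[where f' = "\<lambda>x v. f x * g' x v + f' x v * g x"])
    show "Ck_on k S (\<lambda>x. f x * g' x v + f' x v * g x)" for v
      using Suc.prems[THEN Ck_on_Suc_imp] by (intro Ck_on_add Suc.IH f'(2) g'(2))
  qed (intro has_derivative_mult f' g')
qed (auto intro: continuous_on_mult)

lemma Ck_on_sum:
  "finite I \<Longrightarrow> (\<And>i. i \<in> I \<Longrightarrow> Ck_on k S (f i)) \<Longrightarrow> Ck_on k S (\<lambda>x. \<Sum>i\<in>I. f i x)"
  by (induction I rule: finite_induct) (auto intro: Ck_on_const Ck_on_add)

text \<open>\<open>Ck_on\<close> is defined for real-valued functions only, hence the inner map is
  treated componentwise. The chain rule writes the derivative as a sum of products to which the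
  induction hypothesis for the derivatives of \<open>f\<close> applies.\<close>

lemma Ck_on_compose:
  assumes "\<And>i. i \<in> Basis \<Longrightarrow> Ck_on k S (\<lambda>x. g x \<bullet> i)" "g ` S \<subseteq> V" "Ck_on k V f"
  shows "Ck_on k S (\<lambda>x. f (g x))"
  using assms
proof (induction k arbitrary: f)
  case 0
  have "continuous_on S g"
    using 0 by (subst continuous_on_componentwise) auto
  with 0 show ?case
    by (auto intro: continuous_on_compose2)
next
  case (Suc k)
  obtain f' where f': "\<And>x. x \<in> V \<Longrightarrow> (f has_derivative f' x) (at x)" "\<And>v. Ck_on k V (\<lambda>x. f' x v)"
    using Suc.prems(3) by (rule Ck_on_SucE) blast
  have "\<forall>i. \<exists>G. i \<in> Basis \<longrightarrow>
      (\<forall>x\<in>S. ((\<lambda>x. g x \<bullet> i) has_derivative G x) (at x)) \<and> (\<forall>v. Ck_on k S (\<lambda>x. G x v))"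
    using Suc.prems(1) by (metis Ck_on.simps(2))
  then obtain G where G: "\<And>i x. i \<in> Basis \<Longrightarrow> x \<in> S \<Longrightarrow> ((\<lambda>x. g x \<bullet> i) has_derivative G i x) (at x)"
      "\<And>i v. i \<in> Basis \<Longrightarrow> Ck_on k S (\<lambda>x. G i x v)"
    by metis
  have g': "(g has_derivative (\<lambda>v. \<Sum>i\<in>Basis. G i x v *\<^sub>R i)) (at x)" if "x \<in> S" for x
    by (subst has_derivative_componentwise_within)
       (auto simp: inner_sum_left inner_Basis if_distrib cong: if_cong intro: G that)
  show ?case
  proof (rule Ck_on_SucI[where f' = "\<lambda>x v. \<Sum>i\<in>Basis. G i x v * f' (g x) i"])
    fix x assume x: "x \<in> S"
    then have fx: "(f has_derivative f' (g x)) (at (g x))"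
      using f' Suc.prems(2) by auto
    have "((\<lambda>x. f (g x)) has_derivative (\<lambda>v. f' (g x) (\<Sum>i\<in>Basis. G i x v *\<^sub>R i))) (at x)"
      using has_derivative_compose[OF g'[OF x] fx] .
    moreover have "f' (g x) (\<Sum>i\<in>Basis. G i x v *\<^sub>R i) = (\<Sum>i\<in>Basis. G i x v * f' (g x) i)" for v
      using has_derivative_linear[OF fx] by (simp add: linear_sum linear_cmul)
    ultimately show "((\<lambda>x. f (g x)) has_derivative (\<lambda>v. \<Sum>i\<in>Basis. G i x v * f' (g x) i)) (at x)"
      by simp
  next
    fix v
    have "Ck_on k S (\<lambda>x. f' (g x) i)" for i
      by (rule Suc.IH[OF Ck_on_Suc_imp[OF Suc.prems(1)] Suc.prems(2) f'(2)])
    then show "Ck_on k S (\<lambda>x. \<Sum>i\<in>Basis. G i x v * f' (g x) i)"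
      by (intro Ck_on_sum Ck_on_mult[OF G(2)]) simp_all
  qed
qed

lemma Ck_on_powr: "Ck_on k {0<..} (\<lambda>r::real. r powr a)"
proof (induction k arbitrary: a)
  case 0
  show ?case
    by (auto intro!: continuous_intros)
next
  case (Suc k)
  show ?case
  proof (rule Ck_on_SucI[where f' = "\<lambda>r v. (a * v) * r powr (a - 1)"])
    fix r :: real assume "r \<in> {0<..}"
    then have "((\<lambda>r. r powr a) has_real_derivative a * r powr (a - 1)) (at r)"
      by (auto intro: has_real_derivative_powr)
    then show "((\<lambda>r. r powr a) has_derivative (\<lambda>v. a * v * r powr (a - 1))) (at r)"
      unfolding has_field_derivative_def
      by (rule has_derivative_eq_rhs) (simp add: fun_eq_iff)
  qed (intro Ck_on_mult Ck_on_const Suc)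
qed

lemma Ck_ext_imp_Ck_on: "open S \<Longrightarrow> Ck_ext k S D f \<Longrightarrow> S \<subseteq> D \<Longrightarrow> Ck_on k S f"
proof (induction k arbitrary: f)
  case 0
  then obtain F where "continuous_on D F" "\<forall>x\<in>S. F x = f x"
    by auto
  then show ?case
    using \<open>S \<subseteq> D\<close> by (metis Ck_on.simps(1) continuous_on_cong continuous_on_subset)
next
  case (Suc k)
  define f' where "f' x = frechet_derivative f (at x)" for x
  have f': "(f has_derivative f' x) (at x)" if "x \<in> S" for x
    using that Suc.prems by (auto simp: f'_def frechet_derivative_works)
  have Ck: "Ck_on k S (\<lambda>x. f' x b)" if "b \<in> Basis" for b
    using that Suc by (auto simp: f'_def)
  have "Ck_on k S (\<lambda>x. f' x v)" for v
  proof (rule Ck_on_cong[OF \<open>open S\<close>])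
    show "Ck_on k S (\<lambda>x. \<Sum>b\<in>Basis. (v \<bullet> b) * f' x b)"
      by (intro Ck_on_sum Ck_on_mult Ck_on_const Ck) auto
    fix x assume "x \<in> S"
    then have lin: "linear (f' x)"
      using f' has_derivative_linear by blast
    have "f' x v = f' x (\<Sum>b\<in>Basis. (v \<bullet> b) *\<^sub>R b)"
      by (simp add: euclidean_representation)
    then show "(\<Sum>b\<in>Basis. (v \<bullet> b) * f' x b) = f' x v"
      by (simp add: linear_sum[OF lin] linear_cmul[OF lin])
  qed
  with f' show ?case
    by (blast intro: Ck_on_SucI)
qed

text \<open>The mean value theorem is applied twice: in direction \<open>v\<close> to the difference
  of \<open>f\<close> along two parallel segments, then in direction \<open>w\<close> to the
  resulting difference of \<open>f'\<close>.\<close>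

lemma double_difference:
  fixes f :: "'a::real_normed_vector \<Rightarrow> real"
  assumes r: "r > 0"
    and S: "\<And>a b. 0 \<le> a \<Longrightarrow> a \<le> r \<Longrightarrow> 0 \<le> b \<Longrightarrow> b \<le> r \<Longrightarrow> q + a *\<^sub>R v + b *\<^sub>R w \<in> S"
    and f: "\<And>x. x \<in> S \<Longrightarrow> (f has_derivative f' x) (at x)"
    and g: "\<And>x. x \<in> S \<Longrightarrow> ((\<lambda>x. f' x v) has_derivative g x) (at x)"
  shows "\<exists>a b. 0 \<le> a \<and> a \<le> r \<and> 0 \<le> b \<and> b \<le> r \<and>
    f (q + r *\<^sub>R v + r *\<^sub>R w) - f (q + r *\<^sub>R v) - f (q + r *\<^sub>R w) + f q
      = r * (r * g (q + a *\<^sub>R v + b *\<^sub>R w) w)"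
proof -
  have line: "((\<lambda>s. h (c + s *\<^sub>R u)) has_real_derivative h' u) (at s)"
    if "(h has_derivative h') (at (c + s *\<^sub>R u))" for h :: "'a \<Rightarrow> real" and h' c u s
  proof -
    have "((\<lambda>s. h (c + s *\<^sub>R u)) has_derivative (\<lambda>t. h' (t *\<^sub>R u))) (at s)"
      by (rule has_derivative_compose[where f = "\<lambda>s. c + s *\<^sub>R u" and g = h, OF _ that]) (auto intro!: derivative_eq_intros)
    moreover have "(\<lambda>t. h' (t *\<^sub>R u)) = (\<lambda>t. h' u * t)"
      using has_derivative_linear[OF that] by (simp add: linear_cmul mult.commute)
    ultimately show ?thesis
      by (simp add: has_field_derivative_def)
  qed
  define F where "F s = f ((q + r *\<^sub>R w) + s *\<^sub>R v) - f (q + s *\<^sub>R v)" for s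
  have "\<exists>a. 0 < a \<and> a < r \<and> F r - F 0 = (r - 0) * (f' (q + r *\<^sub>R w + a *\<^sub>R v) v - f' (q + a *\<^sub>R v) v)"
  proof (rule MVT2[OF r])
    fix s assume s: "0 \<le> s" "s \<le> r"
    have "q + r *\<^sub>R w + s *\<^sub>R v \<in> S" "q + s *\<^sub>R v \<in> S"
      using S[of s r] S[of s 0] s r by (auto simp: algebra_simps)
    then show "(F has_real_derivative f' (q + r *\<^sub>R w + s *\<^sub>R v) v - f' (q + s *\<^sub>R v) v) (at s)"
      unfolding F_def by (intro DERIV_diff line f)
  qed
  then obtain a where a: "0 < a" "a < r"
      "F r - F 0 = r * (f' (q + r *\<^sub>R w + a *\<^sub>R v) v - f' (q + a *\<^sub>R v) v)"
    by auto
  have "\<exists>b. 0 < b \<and> b < r \<and> f' (q + a *\<^sub>R v + r *\<^sub>R w) v - f' (q + a *\<^sub>R v + 0 *\<^sub>R w) v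
      = (r - 0) * g (q + a *\<^sub>R v + b *\<^sub>R w) w"
  proof (rule MVT2[OF r])
    fix s assume s: "0 \<le> s" "s \<le> r"
    show "((\<lambda>s. f' (q + a *\<^sub>R v + s *\<^sub>R w) v) has_real_derivative g (q + a *\<^sub>R v + s *\<^sub>R w) w) (at s)"
      by (rule line[where h = "\<lambda>x. f' x v"]) (intro g S, use s a in auto)
  qed
  then obtain b where b: "0 < b" "b < r"
      "f' (q + a *\<^sub>R v + r *\<^sub>R w) v - f' (q + a *\<^sub>R v) v = r * g (q + a *\<^sub>R v + b *\<^sub>R w) w"
    by auto
  have "F r - F 0 = r * (r * g (q + a *\<^sub>R v + b *\<^sub>R w) w)"
    using a(3) b(3) by (simp add: add.commute add.left_commute)
  then show ?thesis
    using a b by (intro exI[of _ a] exI[of _ b]) (auto simp: F_def algebra_simps)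
qed

text \<open>The second difference over a parallelogram is symmetric in \<open>v\<close> and
  \<open>w\<close>, while \<open>double_difference\<close> expresses it by either mixed derivative
  at a nearby point. Continuity at \<open>q\<close> forces both to agree.\<close>

lemma second_derivative_symmetric:
  fixes f :: "'a::real_normed_vector \<Rightarrow> real"
  assumes "open S" "q \<in> S"
    and f: "\<And>x. x \<in> S \<Longrightarrow> (f has_derivative f' x) (at x)"
    and g: "\<And>x. x \<in> S \<Longrightarrow> ((\<lambda>x. f' x v) has_derivative g x) (at x)"
    and h: "\<And>x. x \<in> S \<Longrightarrow> ((\<lambda>x. f' x w) has_derivative h x) (at x)"
    and contg: "continuous_on S (\<lambda>x. g x w)" and conth: "continuous_on S (\<lambda>x. h x v)"
  shows "g q w = h q v"
proof (rule ccontr)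
  assume neq: "g q w \<noteq> h q v"
  define \<epsilon> where "\<epsilon> = \<bar>g q w - h q v\<bar> / 2"
  have \<epsilon>: "\<epsilon> > 0"
    using neq by (simp add: \<epsilon>_def)
  have "isCont (\<lambda>x. g x w) q" "isCont (\<lambda>x. h x v) q"
    using contg conth \<open>open S\<close> \<open>q \<in> S\<close> by (auto simp: continuous_on_eq_continuous_at)
  then obtain d1 d2 where d1: "d1 > 0" "\<And>x. dist x q < d1 \<Longrightarrow> dist (g x w) (g q w) < \<epsilon>"
    and d2: "d2 > 0" "\<And>x. dist x q < d2 \<Longrightarrow> dist (h x v) (h q v) < \<epsilon>"
    using \<epsilon> unfolding continuous_at_eps_delta by metis
  obtain d3 where d3: "d3 > 0" "ball q d3 \<subseteq> S"
    using \<open>open S\<close> \<open>q \<in> S\<close> by (meson openE)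
  define d where "d = min d1 (min d2 d3)"
  have d: "d > 0" "d \<le> d1" "d \<le> d2" "d \<le> d3"
    using d1 d2 d3 by (auto simp: d_def)
  \<comment> \<open>This size keeps the whole parallelogram within distance \<open>d\<close> of
    \<open>q\<close>; the summand 1 covers \<open>v = w = 0\<close>.\<close>
  define r where "r = d / (norm v + norm w + 1)"
  have nz: "norm v + norm w + 1 > 0"
    by (smt (verit) norm_ge_zero)
  then have r: "r > 0"
    using d by (simp add: r_def)
  have near: "dist (q + a *\<^sub>R v + b *\<^sub>R w) q < d" "dist (q + b *\<^sub>R w + a *\<^sub>R v) q < d"
    if "0 \<le> a" "a \<le> r" "0 \<le> b" "b \<le> r" for a b
  proof -
    have "norm (a *\<^sub>R v + b *\<^sub>R w) \<le> a * norm v + b * norm w"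
      using that by (metis abs_of_nonneg norm_scaleR norm_triangle_ineq)
    also have "\<dots> \<le> r * norm v + r * norm w"
      using that by (intro add_mono mult_right_mono) auto
    also have "\<dots> < r * (norm v + norm w + 1)"
      using r by (simp add: algebra_simps)
    also have "\<dots> = d"
      using nz by (simp add: r_def)
    finally have "norm (a *\<^sub>R v + b *\<^sub>R w) < d" .
    then show "dist (q + a *\<^sub>R v + b *\<^sub>R w) q < d" "dist (q + b *\<^sub>R w + a *\<^sub>R v) q < d"
      by (simp_all add: dist_norm algebra_simps)
  qed
  have inS: "x \<in> S" if "dist x q < d" for x
    using that d d3 by (auto simp: dist_commute)
  obtain a b where ab: "0 \<le> a" "a \<le> r" "0 \<le> b" "b \<le> r"
    "f (q + r *\<^sub>R v + r *\<^sub>R w) - f (q + r *\<^sub>R v) - f (q + r *\<^sub>R w) + f q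
      = r * (r * g (q + a *\<^sub>R v + b *\<^sub>R w) w)"
    using double_difference[OF r inS[OF near(1)] f g] by blast
  obtain a' b' where ab': "0 \<le> a'" "a' \<le> r" "0 \<le> b'" "b' \<le> r"
    "f (q + r *\<^sub>R w + r *\<^sub>R v) - f (q + r *\<^sub>R w) - f (q + r *\<^sub>R v) + f q
      = r * (r * h (q + a' *\<^sub>R w + b' *\<^sub>R v) v)"
    using double_difference[OF r inS[OF near(2)] f h] by blast
  have "r * (r * g (q + a *\<^sub>R v + b *\<^sub>R w) w) = r * (r * h (q + a' *\<^sub>R w + b' *\<^sub>R v) v)"
    using ab(5) ab'(5) by (simp add: algebra_simps)
  then have eq: "g (q + a *\<^sub>R v + b *\<^sub>R w) w = h (q + a' *\<^sub>R w + b' *\<^sub>R v) v"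
    using r by simp
  have "dist (g (q + a *\<^sub>R v + b *\<^sub>R w) w) (g q w) < \<epsilon>"
    using near(1)[OF ab(1-4)] d by (intro d1) linarith
  moreover have "dist (h (q + a' *\<^sub>R w + b' *\<^sub>R v) v) (h q v) < \<epsilon>"
    using near(2)[OF ab'(3,4,1,2)] d by (intro d2) linarith
  ultimately show False
    unfolding eq \<epsilon>_def dist_real_def by (simp add: abs_if field_simps split: if_splits)
qed

text \<open>The form is constant, so raising an index with it commutes with differentiation:
  \<open>gr\<close>, \<open>A\<close>, \<open>B\<close> are the first, second and third derivatives
  of \<open>U\<close> with one index raised, and their symmetries are those of mixed partial
  derivatives.\<close>

lemma Ck_on_lorentz_gradient:
  fixes U :: "('n::finite) mink \<Rightarrow> real"
  assumes "open S" "Ck_on 3 S U"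
  obtains gr A B where
    "\<And>x. x \<in> S \<Longrightarrow> (U has_derivative lorentz (gr x)) (at x)"
    "\<And>x. x \<in> S \<Longrightarrow> (gr has_derivative A x) (at x)"
    "\<And>x v. x \<in> S \<Longrightarrow> ((\<lambda>y. A y v) has_derivative (\<lambda>w. B x w v)) (at x)"
    "\<And>x v w. x \<in> S \<Longrightarrow> lorentz (A x v) w = lorentz v (A x w)"
    "\<And>x v w. x \<in> S \<Longrightarrow> B x w v = B x v w"
proof -
  have "Ck_on (Suc (Suc (Suc 0))) S U"
    using assms(2) by (simp add: numeral_3_eq_3)
  then obtain U' where U': "\<And>x. x \<in> S \<Longrightarrow> (U has_derivative U' x) (at x)"
      "\<And>v. Ck_on (Suc (Suc 0)) S (\<lambda>x. U' x v)"
    by (metis Ck_on_SucE)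
  have "\<forall>v. \<exists>G. (\<forall>x\<in>S. ((\<lambda>x. U' x v) has_derivative G x) (at x)) \<and> (\<forall>w. Ck_on (Suc 0) S (\<lambda>x. G x w))"
    using U'(2) by (metis Ck_on.simps(2))
  then obtain U2 where U2: "\<And>v x. x \<in> S \<Longrightarrow> ((\<lambda>x. U' x v) has_derivative U2 v x) (at x)"
      "\<And>v w. Ck_on (Suc 0) S (\<lambda>x. U2 v x w)"
    by metis
  have "\<forall>v w. \<exists>G. (\<forall>x\<in>S. ((\<lambda>x. U2 v x w) has_derivative G x) (at x)) \<and> (\<forall>z. Ck_on 0 S (\<lambda>x. G x z))"
    using U2(2) by (metis Ck_on.simps(2))
  then obtain U3 where U3: "\<And>v w x. x \<in> S \<Longrightarrow> ((\<lambda>x. U2 v x w) has_derivative U3 v w x) (at x)"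
      "\<And>v w z. continuous_on S (\<lambda>x. U3 v w x z)"
    unfolding Ck_on.simps(1) by metis
  have U2c: "continuous_on S (\<lambda>x. U2 v x w)" for v w
    using Ck_on_Suc_imp[OF U2(2)] by simp
  have sym2: "U2 v x w = U2 w x v" if "x \<in> S" for x v w
    by (rule second_derivative_symmetric[OF \<open>open S\<close> that U'(1) U2(1) U2(1) U2c U2c])
  have sym3: "U3 b v x w = U3 b w x v" if "x \<in> S" for x b v w
    by (rule second_derivative_symmetric[OF \<open>open S\<close> that U2(1) U3(1) U3(1) U3(2) U3(2)])
  \<comment> \<open>Pairing with \<open>flip_time b\<close>, the Lorentz-dual basis, raises the
    index.\<close>
  define gr where "gr x = (\<Sum>b\<in>Basis. U' x b *\<^sub>R flip_time b)" for x
  define A where "A x v = (\<Sum>b\<in>Basis. U2 b x v *\<^sub>R flip_time b)" for x v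
  define B where "B x w v = (\<Sum>b\<in>Basis. U3 b v x w *\<^sub>R flip_time b)" for x w v
  have gr: "lorentz (gr x) v = U' x v" if "x \<in> S" for x v
  proof -
    have lin: "linear (U' x)"
      using U'(1) that has_derivative_linear by blast
    have "lorentz (gr x) v = (\<Sum>b\<in>Basis. (v \<bullet> b) * U' x b)"
      by (simp add: gr_def lorentz.sum_left lorentz.scaleR_left lorentz_flip_time inner_commute mult.commute)
    also have "\<dots> = U' x (\<Sum>b\<in>Basis. (v \<bullet> b) *\<^sub>R b)"
      by (simp add: linear_sum[OF lin] linear_cmul[OF lin])
    finally show ?thesis
      by (simp add: euclidean_representation)
  qed
  have grA: "(gr has_derivative A x) (at x)" if "x \<in> S" for x
    unfolding gr_def A_def using that
    by (intro has_derivative_sum has_derivative_scaleR_left U2)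
  have A: "lorentz (A x v) w = U2 w x v" if x: "x \<in> S" for x v w
  proof -
    have "((\<lambda>x. lorentz (gr x) w) has_derivative (\<lambda>v. lorentz (A x v) w)) (at x)"
      using lorentz.FDERIV[OF grA[OF x] has_derivative_const[of w]]
      by (simp add: lorentz.zero_right)
    then have "((\<lambda>x. U' x w) has_derivative (\<lambda>v. lorentz (A x v) w)) (at x)"
      by (rule has_derivative_transform_within_open[OF _ \<open>open S\<close> x]) (simp add: gr)
    then show ?thesis
      using has_derivative_unique[OF U2(1)[OF x]] by metis
  qed
  show thesis
  proof (rule that[of gr A B])
    show "(U has_derivative lorentz (gr x)) (at x)" if "x \<in> S" for x
      using U'(1)[OF that] gr[OF that] by (metis ext)
    show "((\<lambda>y. A y v) has_derivative (\<lambda>w. B x w v)) (at x)" if "x \<in> S" for x v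
      unfolding A_def B_def using that
      by (intro has_derivative_sum has_derivative_scaleR_left U3)
    show "lorentz (A x v) w = lorentz v (A x w)" if "x \<in> S" for x v w
      unfolding lorentz_commute[of v] A[OF that] by (rule sym2[OF that])
    show "B x w v = B x v w" if "x \<in> S" for x v w
      unfolding B_def sym3[OF that, of _ v w] ..
  qed (fact grA)
qed

section \<open>The hyperboloid and functions on it\<close>

lemma hyp_param_in_hyp_space: "hyp_param y \<in> hyp_space"
  by (auto simp: hyp_param_def hyp_space_def lorentz_def add_pos_nonneg)

lemma fst_hyp_param [simp]: "fst (hyp_param y) = y"
  by (simp add: hyp_param_def)

lemma hyp_param_fst:
  assumes "q \<in> hyp_space"
  shows "hyp_param (fst q) = q"
proof -
  have "1 + fst q \<bullet> fst q = (snd q)\<^sup>2" "snd q > 0"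
    using assms by (auto simp: hyp_space_def lorentz_def power2_eq_square)
  then show ?thesis
    by (simp add: hyp_param_def prod_eq_iff)
qed

lemma continuous_on_hyp_param: "continuous_on S hyp_param"
  unfolding hyp_param_def by (intro continuous_intros)

lemma lorentz_hyp_space: "q \<in> hyp_space \<Longrightarrow> lorentz q q = -1"
  by (simp add: hyp_space_def)

lemma tangent_part: "q \<in> hyp_space \<Longrightarrow> v + lorentz q v *\<^sub>R q \<in> hyp_tangent q"
  by (simp add: hyp_tangent_def lorentz.add_right lorentz.scaleR_right lorentz_hyp_space)

text \<open>Tangency determines the time component by \<open>y \<bullet> v1 = \<tau> * v2\<close>,
  and Cauchy-Schwarz then bounds \<open>v2\<close> by the form itself. The second estimate passes
  from the intrinsic norm to the Euclidean one, in which the derivative of \<open>H\<close> is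
  bounded.\<close>

lemma tangent_lorentz:
  assumes q: "q \<in> hyp_space" and v: "v \<in> hyp_tangent q"
  shows "0 \<le> lorentz v v" "(norm v)\<^sup>2 \<le> 2 * (snd q)\<^sup>2 * lorentz v v"
proof -
  define y \<tau> v1 v2 where "y = fst q" and "\<tau> = snd q" and "v1 = fst v" and "v2 = snd v"
  have \<tau>: "\<tau>\<^sup>2 = 1 + y \<bullet> y"
    using q by (auto simp: hyp_space_def lorentz_def y_def \<tau>_def power2_eq_square)
  have yv: "y \<bullet> v1 = \<tau> * v2"
    using v by (simp add: hyp_tangent_def lorentz_def y_def \<tau>_def v1_def v2_def)
  have L: "lorentz v v = v1 \<bullet> v1 - v2\<^sup>2"
    by (simp add: lorentz_def v1_def v2_def power2_eq_square)
  have "(\<tau> * v2)\<^sup>2 \<le> (y \<bullet> y) * (v1 \<bullet> v1)"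
    using Cauchy_Schwarz_ineq[of y v1] by (simp add: yv)
  also have "\<dots> = (\<tau>\<^sup>2 - 1) * (lorentz v v + v2\<^sup>2)"
    using \<tau> L by simp
  finally have v2: "v2\<^sup>2 \<le> (\<tau>\<^sup>2 - 1) * lorentz v v"
    by (simp add: power_mult_distrib algebra_simps)
  have "v1 \<bullet> v1 \<le> \<tau>\<^sup>2 * lorentz v v"
    using v2 L by (simp add: left_diff_distrib)
  then have "0 \<le> \<tau>\<^sup>2 * lorentz v v"
    using inner_ge_zero[of v1] by linarith
  moreover have "\<tau>\<^sup>2 > 0"
    using \<tau> inner_ge_zero[of y] by linarith
  ultimately show pos: "0 \<le> lorentz v v"
    by (simp add: zero_le_mult_iff)
  have "(norm v)\<^sup>2 = v1 \<bullet> v1 + v2\<^sup>2"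
    by (simp add: norm_prod_def v1_def v2_def power2_norm_eq_inner)
  also have "\<dots> = lorentz v v + 2 * v2\<^sup>2"
    using L by simp
  also have "\<dots> \<le> 2 * \<tau>\<^sup>2 * lorentz v v"
    using v2 pos by (simp add: algebra_simps)
  finally show "(norm v)\<^sup>2 \<le> 2 * (snd q)\<^sup>2 * lorentz v v"
    by (simp add: \<tau>_def)
qed

text \<open>Both derivatives are tested along one curve in the hyperboloid through \<open>q\<close>
  with velocity \<open>v\<close>; for \<open>v\<close> tangent such a curve is the chart lift of a
  straight line.\<close>

lemma hyp_derivative_unique:
  fixes f :: "('n::finite) mink \<Rightarrow> 'b::real_normed_vector"
  assumes q: "q \<in> hyp_space" and v: "v \<in> hyp_tangent q"
    and A: "(f has_derivative A) (at q within hyp_space)"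
    and B: "(f has_derivative B) (at q within hyp_space)"
  shows "A v = B v"
proof -
  define c where "c t = hyp_param (fst q + t *\<^sub>R fst v)" for t
  have c0: "c 0 = q"
    using q by (simp add: c_def hyp_param_fst)
  have sq: "sqrt (1 + fst q \<bullet> fst q) = snd q" "snd q > 0" "1 + fst q \<bullet> fst q > 0"
    using hyp_param_fst[OF q] q by (auto simp: hyp_param_def prod_eq_iff hyp_space_def add_pos_nonneg)
  have v2: "snd v = (fst q \<bullet> fst v) / snd q"
    using v sq by (simp add: hyp_tangent_def lorentz_def field_simps)
  have "((\<lambda>t. 1 + (fst q + t *\<^sub>R fst v) \<bullet> (fst q + t *\<^sub>R fst v)) has_real_derivative
      2 * (fst q \<bullet> fst v)) (at 0)"
  proof -
    have "1 + (fst q + t *\<^sub>R fst v) \<bullet> (fst q + t *\<^sub>R fst v)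
        = 1 + fst q \<bullet> fst q + 2 * (fst q \<bullet> fst v) * t + (fst v \<bullet> fst v) * t\<^sup>2" for t
      by (simp add: inner_add_left inner_add_right inner_commute power2_eq_square)
    then show ?thesis
      by (simp only:) (auto intro!: derivative_eq_intros)
  qed
  then have "((\<lambda>t. sqrt (1 + (fst q + t *\<^sub>R fst v) \<bullet> (fst q + t *\<^sub>R fst v))) has_real_derivative
      inverse (sqrt (1 + fst q \<bullet> fst q)) / 2 * (2 * (fst q \<bullet> fst v))) (at 0)"
    by (rule DERIV_chain2[rotated]) (simp add: DERIV_real_sqrt[OF sq(3)])
  also have "inverse (sqrt (1 + fst q \<bullet> fst q)) / 2 * (2 * (fst q \<bullet> fst v)) = snd v"
    unfolding sq(1) v2 using sq(2) by (simp add: field_simps)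
  finally have "((\<lambda>t. sqrt (1 + (fst q + t *\<^sub>R fst v) \<bullet> (fst q + t *\<^sub>R fst v))) has_real_derivative
      snd v) (at 0)" .
  then have "(c has_derivative (\<lambda>t. (t *\<^sub>R fst v, snd v * t))) (at 0)"
    unfolding c_def hyp_param_def has_field_derivative_def
    by (intro has_derivative_Pair has_derivative_eq_rhs[OF has_derivative_add[OF has_derivative_const
          has_derivative_scaleR_left[OF has_derivative_ident]]]) auto
  also have "(\<lambda>t. (t *\<^sub>R fst v, snd v * t)) = (\<lambda>t. t *\<^sub>R v)"
    by (auto simp: prod_eq_iff)
  finally have c: "(c has_derivative (\<lambda>t. t *\<^sub>R v)) (at 0)" .
  have comp: "((\<lambda>t. f (c t)) has_derivative (\<lambda>t. D (t *\<^sub>R v))) (at 0)"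
    if "(f has_derivative D) (at q within hyp_space)" for D
  proof (rule has_derivative_in_compose[OF c])
    show "(f has_derivative D) (at (c 0) within range c)"
      unfolding c0 using that
      by (rule has_derivative_subset) (auto simp: c_def hyp_param_in_hyp_space)
  qed
  have "(\<lambda>t. A (t *\<^sub>R v)) = (\<lambda>t. B (t *\<^sub>R v))"
    using has_derivative_unique[OF comp[OF A] comp[OF B]] .
  from fun_cong[OF this, of 1] show ?thesis
    by simp
qed

text \<open>\<open>hyp_grad\<close> asks for the full form \<open>lorentz w\<close> as a derivative
  within \<open>hyp_space\<close>, whereas \<open>A\<close> agrees with it only on tangent vectors.
  The two differ by a multiple of the differential of \<open>lorentz p p + 1\<close>, a function
  vanishing on the hyperboloid.\<close>

lemma hyp_grad_eqI:
  assumes q: "q \<in> hyp_space" and w: "w \<in> hyp_tangent q"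
    and A: "(u has_derivative A) (at q within hyp_space)"
    and eq: "\<And>v. v \<in> hyp_tangent q \<Longrightarrow> A v = lorentz w v"
  shows "hyp_grad u q = w"
  unfolding hyp_grad_def
proof (rule the_equality)
  have wq: "lorentz w q = 0"
    using w by (simp add: hyp_tangent_def lorentz_commute)
  have A': "A v + A q * lorentz q v = lorentz w v" for v
  proof -
    have "A (v + lorentz q v *\<^sub>R q) = A v + lorentz q v * A q"
      using has_derivative_linear[OF A] by (simp add: linear_add linear_cmul)
    then show ?thesis
      using eq[OF tangent_part[OF q, of v]]
      by (simp add: lorentz.add_right lorentz.scaleR_right wq mult.commute)
  qed
  \<comment> \<open>The coefficient \<open>A q / 2\<close> is what makes the radial value of the
    corrected derivative zero.\<close>
  have "((\<lambda>p. u p + (A q / 2) * (lorentz p p + 1)) has_derivative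
      (\<lambda>v. A v + (A q / 2) * ((lorentz q v + lorentz v q) + 0))) (at q within hyp_space)"
    by (intro has_derivative_add A has_derivative_mult_right lorentz.FDERIV has_derivative_ident
        has_derivative_const)
  moreover have "(\<lambda>v. A v + (A q / 2) * ((lorentz q v + lorentz v q) + 0)) = lorentz w"
    using A' by (auto simp: lorentz_commute[of _ q])
  ultimately have "((\<lambda>p. u p + (A q / 2) * (lorentz p p + 1)) has_derivative lorentz w)
      (at q within hyp_space)"
    by simp
  then have D: "(u has_derivative lorentz w) (at q within hyp_space)"
    by (rule has_derivative_transform[rotated 2]) (auto simp: q lorentz_hyp_space)
  with w show "w \<in> hyp_tangent q \<and> (u has_derivative lorentz w) (at q within hyp_space)"
    by simp
  fix w' assume w': "w' \<in> hyp_tangent q \<and> (u has_derivative lorentz w') (at q within hyp_space)"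
  have "lorentz (w' - w) v = 0" for v
  proof -
    have "lorentz w' (v + lorentz q v *\<^sub>R q) = lorentz w (v + lorentz q v *\<^sub>R q)"
      using hyp_derivative_unique[OF q tangent_part[OF q] _ D] w' by blast
    moreover have "lorentz w' q = 0"
      using w' by (simp add: hyp_tangent_def lorentz_commute)
    ultimately show ?thesis
      using wq by (simp add: lorentz.add_right lorentz.scaleR_right lorentz.diff_left)
  qed
  then show "w' = w"
    using lorentz_nondegenerate by (metis eq_iff_diff_eq_0)
qed

text \<open>In the chart \<open>fst\<close> the metric matrix is the identity minus
  \<open>y y^T / (1 + |y|^2)\<close>, with inverse the identity plus \<open>y y^T\<close>. The first
  component applies this inverse to the chart differential \<open>g\<close>; the second is then
  forced by tangency.\<close>

definition grad_coord :: "real^('n::finite) \<Rightarrow> real^'n \<Rightarrow> 'n mink" where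
  "grad_coord y g = (g + (y \<bullet> g) *\<^sub>R y, sqrt (1 + y \<bullet> y) * (y \<bullet> g))"

lemma hyp_grad_coord:
  assumes q: "q \<in> hyp_space"
    and f: "((\<lambda>y. u (hyp_param y)) has_derivative (\<lambda>h. g \<bullet> h)) (at (fst q))"
  shows "hyp_grad u q = grad_coord (fst q) g"
proof (rule hyp_grad_eqI[OF q])
  define y where "y = fst q"
  have sq: "snd q = sqrt (1 + y \<bullet> y)"
    using hyp_param_fst[OF q] by (simp add: hyp_param_def prod_eq_iff y_def)
  have sq2: "sqrt (1 + y \<bullet> y) * sqrt (1 + y \<bullet> y) = 1 + y \<bullet> y"
    by (simp add: add_nonneg_nonneg)
  have "lorentz q (grad_coord y g) = (y \<bullet> g) * (1 + y \<bullet> y - sqrt (1 + y \<bullet> y) * sqrt (1 + y \<bullet> y))"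
    unfolding lorentz_def grad_coord_def fst_conv snd_conv y_def[symmetric] sq
    by (simp add: inner_add_right algebra_simps del: real_sqrt_mult_self)
  then show "grad_coord (fst q) g \<in> hyp_tangent q"
    by (simp add: hyp_tangent_def sq2 y_def[symmetric])
  have "((\<lambda>p. u (hyp_param (fst p))) has_derivative (\<lambda>v. g \<bullet> fst v)) (at q within hyp_space)"
    by (rule has_derivative_compose[where f = fst and g = "\<lambda>y. u (hyp_param y)", OF _ f])
       (auto intro!: derivative_eq_intros)
  then show "(u has_derivative (\<lambda>v. g \<bullet> fst v)) (at q within hyp_space)"
    by (rule has_derivative_transform[rotated 2]) (auto simp: q hyp_param_fst)
  fix v assume "v \<in> hyp_tangent q"
  then have "y \<bullet> fst v = sqrt (1 + y \<bullet> y) * snd v"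
    by (simp add: hyp_tangent_def lorentz_def y_def[symmetric] sq)
  then show "g \<bullet> fst v = lorentz (grad_coord (fst q) g) v"
    by (simp add: lorentz_def grad_coord_def y_def[symmetric] inner_add_left)
qed

text \<open>Tangential projection does not affect pairings with tangent vectors, so the divergence
  is a frame sum for \<open>L\<close>. It equals the ambient trace because the missing term
  \<open>lorentz (L q) q\<close> vanishes: differentiate \<open>lorentz (Y x) x = 0\<close> in the
  direction \<open>q\<close>.\<close>

lemma hyp_div_eq_trace:
  fixes X Y :: "('n::finite) mink \<Rightarrow> 'n mink"
  assumes \<Omega>: "openin (top_of_set hyp_space) \<Omega>" and q: "q \<in> \<Omega>"
    and S: "open S" "q \<in> S"
    and Y: "(Y has_derivative L) (at q)"
    and tang: "\<And>x. x \<in> S \<Longrightarrow> lorentz (Y x) x = 0"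
    and XY: "\<And>x. x \<in> \<Omega> \<Longrightarrow> X x = Y x"
  shows "hyp_div X q = op_trace L"
proof -
  have qh: "q \<in> hyp_space"
    using \<Omega> q openin_imp_subset by blast
  obtain d where d: "d > 0" "ball q d \<inter> hyp_space \<subseteq> \<Omega>"
    using \<Omega> q unfolding openin_contains_ball by blast
  have X: "(X has_derivative L) (at q within hyp_space)"
    by (rule has_derivative_transform_within[OF has_derivative_at_withinI[OF Y] d(1) qh])
       (use XY d in \<open>auto simp: dist_commute\<close>)
  then have X': "(X has_derivative frechet_derivative X (at q within hyp_space)) (at q within hyp_space)"
    using frechet_derivative_works differentiable_def by blast
  define E where "E = (SOME E. hyp_frame q E)"
  have E: "hyp_frame q E"
    unfolding E_def using someI_ex[OF hyp_frame_exists[OF qh]] .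
  have "((\<lambda>x. lorentz (Y x) x) has_derivative (\<lambda>h. lorentz (Y q) h + lorentz (L h) q)) (at q)"
    by (intro lorentz.FDERIV Y has_derivative_ident)
  then have "((\<lambda>x. 0) has_derivative (\<lambda>h. lorentz (Y q) h + lorentz (L h) q)) (at q)"
    by (rule has_derivative_transform_within_open[OF _ S]) (simp add: tang)
  then have "(\<lambda>h. lorentz (Y q) h + lorentz (L h) q) = (\<lambda>h. 0)"
    using has_derivative_unique has_derivative_const by blast
  from fun_cong[OF this, of q] have Lq: "lorentz (L q) q = 0"
    using tang[OF S(2)] by simp
  have lin: "linear L"
    using Y has_derivative_linear by blast
  have M: "bilinear (\<lambda>v w. lorentz (L v) w)"
    using lin by (auto simp: bilinear_def linear_iff lorentz.add_left lorentz.add_right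
        lorentz.scaleR_left lorentz.scaleR_right)
  have "hyp_div X q = (\<Sum>e\<in>E. lorentz (hyp_cov X q e) e)"
    by (simp add: hyp_div_def E_def)
  also have "\<dots> = (\<Sum>e\<in>E. lorentz (L e) e)"
  proof (rule sum.cong[OF refl])
    fix e assume "e \<in> E"
    then have e: "e \<in> hyp_tangent q"
      using E by (auto simp: hyp_frame_def)
    then have "lorentz q e = 0"
      by (simp add: hyp_tangent_def)
    then show "lorentz (hyp_cov X q e) e = lorentz (L e) e"
      using hyp_derivative_unique[OF qh e X X']
      by (simp add: hyp_cov_def hyp_tangential_def lorentz.add_left lorentz.scaleR_left)
  qed
  also have "\<dots> = op_trace L"
    using hyp_frame_trace[OF lorentz_hyp_space[OF qh] E M] Lq by (simp add: bilin_trace_def op_trace_def)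
  finally show ?thesis .
qed

section \<open>Radial projection of the future cone and the extension constant along rays\<close>

definition future_cone :: "('n::finite) mink set" where
  "future_cone = {x. lorentz x x < 0 \<and> snd x > 0}"

text \<open>Written with \<open>powr\<close>, not a quotient by a square root, because
  \<open>Ck_on_powr\<close> shows that powers are stable under differentiation.\<close>

definition hyp_proj :: "('n::finite) mink \<Rightarrow> 'n mink" where
  "hyp_proj x = (- lorentz x x) powr (-1/2) *\<^sub>R x"

lemma continuous_lorentz [continuous_intros]:
  "continuous_on S f \<Longrightarrow> continuous_on S g \<Longrightarrow> continuous_on S (\<lambda>x. lorentz (f x) (g x))"
  by (rule lorentz.continuous_on)

lemma open_future_cone: "open future_cone"
  unfolding future_cone_def by (intro open_Collect_conj open_Collect_less continuous_intros)

lemma continuous_on_hyp_proj: "continuous_on future_cone hyp_proj"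
  unfolding hyp_proj_def by (intro continuous_intros) (auto simp: future_cone_def)

lemma hyp_proj_in_hyp_space:
  assumes "x \<in> future_cone"
  shows "hyp_proj x \<in> hyp_space"
proof -
  define s where "s = - lorentz x x"
  have s: "s > 0"
    using assms by (simp add: s_def future_cone_def)
  have "s powr (-1/2) * s powr (-1/2) * s = s powr (-1/2 + -1/2 + 1)"
    using s unfolding powr_add by simp
  then have "s powr (-1/2) * s powr (-1/2) * s = 1"
    using s by simp
  then show ?thesis
    using assms s
    by (auto simp: hyp_proj_def hyp_space_def lorentz.scaleR_left lorentz.scaleR_right s_def
        future_cone_def algebra_simps)
qed

lemma hyp_space_subset_future_cone: "hyp_space \<subseteq> future_cone"
  by (auto simp: hyp_space_def future_cone_def)

lemma future_cone_scale: "x \<in> future_cone \<Longrightarrow> \<rho> > 0 \<Longrightarrow> \<rho> *\<^sub>R x \<in> future_cone"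
  by (auto simp: future_cone_def lorentz.scaleR_left lorentz.scaleR_right mult_pos_neg)

lemma hyp_proj_scale:
  assumes "x \<in> future_cone" "\<rho> > 0"
  shows "hyp_proj (\<rho> *\<^sub>R x) = hyp_proj x"
proof -
  define s where "s = - lorentz x x"
  have s: "s > 0"
    using assms by (simp add: s_def future_cone_def)
  have "(\<rho>\<^sup>2) powr (-1/2) = (\<rho> powr 2) powr (-1/2)"
    using assms by simp
  also have "\<dots> * \<rho> = 1"
    using assms unfolding powr_powr by (simp add: powr_minus)
  finally have "(\<rho>\<^sup>2) powr (-1/2) * \<rho> = 1" .
  then have "(\<rho>\<^sup>2 * s) powr (-1/2) * \<rho> = s powr (-1/2)"
    using assms s by (simp add: powr_mult mult.commute mult.left_commute)
  then show ?thesis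
    by (simp add: hyp_proj_def lorentz.scaleR_left lorentz.scaleR_right s_def power2_eq_square mult.assoc)
qed

lemma hyp_proj_id: "q \<in> hyp_space \<Longrightarrow> hyp_proj q = q"
  by (simp add: hyp_proj_def hyp_space_def)

text \<open>Presents the cone as a preimage under the projection, from which its openness
  follows.\<close>

lemma open_ray_cone_eq:
  assumes "\<Omega> \<subseteq> hyp_space"
  shows "open_ray_cone \<Omega> = {x \<in> future_cone. hyp_proj x \<in> \<Omega>}"
proof (intro equalityI subsetI)
  fix x assume "x \<in> open_ray_cone \<Omega>"
  then obtain \<rho> q where "x = \<rho> *\<^sub>R q" "q \<in> \<Omega>" "\<rho> > 0"
    by (auto simp: open_ray_cone_def)
  moreover have "q \<in> future_cone"
    using \<open>q \<in> \<Omega>\<close> assms hyp_space_subset_future_cone by auto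
  ultimately show "x \<in> {x \<in> future_cone. hyp_proj x \<in> \<Omega>}"
    using assms by (auto simp: future_cone_scale hyp_proj_scale hyp_proj_id)
next
  fix x assume x: "x \<in> {x \<in> future_cone. hyp_proj x \<in> \<Omega>}"
  define r where "r = (- lorentz x x) powr (-1/2)"
  have "r > 0"
    using x by (auto simp: r_def future_cone_def)
  then have "x = (1 / r) *\<^sub>R hyp_proj x" "1 / r > 0"
    by (auto simp: hyp_proj_def r_def)
  then show "x \<in> open_ray_cone \<Omega>"
    unfolding open_ray_cone_def using x by blast
qed

lemma open_open_ray_cone:
  assumes "openin (top_of_set hyp_space) \<Omega>"
  shows "open (open_ray_cone \<Omega>)"
proof -
  obtain T where T: "open T" "\<Omega> = hyp_space \<inter> T"
    using assms by (auto simp: openin_open)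
  have "open_ray_cone \<Omega> = future_cone \<inter> hyp_proj -` T"
    using T hyp_proj_in_hyp_space by (subst open_ray_cone_eq) auto
  then show ?thesis
    using continuous_open_preimage[OF continuous_on_hyp_proj open_future_cone T(1)] by simp
qed

lemma open_fst_image:
  assumes "openin (top_of_set hyp_space) \<Omega>"
  shows "open (fst ` \<Omega>)"
proof -
  obtain T where T: "open T" "\<Omega> = hyp_space \<inter> T"
    using assms by (auto simp: openin_open)
  have "fst ` \<Omega> = hyp_param -` T"
  proof (intro equalityI subsetI)
    fix y assume "y \<in> hyp_param -` T"
    then have "hyp_param y \<in> \<Omega>" "fst (hyp_param y) = y"
      using T hyp_param_in_hyp_space by auto
    then show "y \<in> fst ` \<Omega>"
      by force
  next
    fix y assume "y \<in> fst ` \<Omega>"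
    then obtain x where "y = fst x" "x \<in> hyp_space" "x \<in> T"
      using T by blast
    then show "y \<in> hyp_param -` T"
      by (simp add: hyp_param_fst)
  qed
  then show ?thesis
    using continuous_open_preimage[OF continuous_on_hyp_param open_UNIV T(1)] by simp
qed

text \<open>On the future cone this is \<open>u (hyp_proj x)\<close>; the detour through the chart exposes the
  function of which differentiability is assumed.\<close>

definition cone_ext :: "(('n::finite) mink \<Rightarrow> real) \<Rightarrow> 'n mink \<Rightarrow> real" where
  "cone_ext u x = u (hyp_param (fst (hyp_proj x)))"

lemma cone_ext_hyp_space: "q \<in> hyp_space \<Longrightarrow> cone_ext u q = u q"
  by (simp add: cone_ext_def hyp_proj_id hyp_param_fst)

lemma cone_ext_scale: "x \<in> future_cone \<Longrightarrow> \<rho> > 0 \<Longrightarrow> cone_ext u (\<rho> *\<^sub>R x) = cone_ext u x"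
  by (simp add: cone_ext_def hyp_proj_scale)

lemma Ck_on_cone_ext:
  fixes u :: "('n::finite) mink \<Rightarrow> real"
  assumes "\<Omega> \<subseteq> hyp_space" "Ck_on k (fst ` \<Omega>) (\<lambda>y. u (hyp_param y))"
  shows "Ck_on k (open_ray_cone \<Omega>) (cone_ext u)"
  unfolding cone_ext_def
proof (rule Ck_on_compose[OF _ _ assms(2)])
  show "(\<lambda>x. fst (hyp_proj x)) ` open_ray_cone \<Omega> \<subseteq> fst ` \<Omega>"
    using assms(1) by (auto simp: open_ray_cone_eq)
  fix i :: "real^'n" assume i: "i \<in> Basis"
  have lin: "Ck_on k S (\<lambda>x::'n mink. fst x \<bullet> b)" "Ck_on k S (\<lambda>x::'n mink. snd x)" for S b
    by (auto intro!: Ck_on_linear bounded_linear_intros)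
  have s: "Ck_on k S (\<lambda>x::'n mink. - lorentz x x)" for S
  proof -
    have "- lorentz x x = snd x * snd x + (-1) * (\<Sum>b\<in>Basis. (fst x \<bullet> b) * (fst x \<bullet> b))"
      for x :: "'n mink"
      unfolding lorentz_def euclidean_inner[symmetric] by simp
    then show ?thesis
      by (simp only:) (intro Ck_on_add Ck_on_sum Ck_on_mult Ck_on_const lin; simp)
  qed
  have "Ck_on k (open_ray_cone \<Omega>) (\<lambda>x. (- lorentz x x) powr (-1/2))"
  proof (rule Ck_on_compose[OF _ _ Ck_on_powr[of k "-1/2"]])
    show "(\<lambda>x. - lorentz x x) ` open_ray_cone \<Omega> \<subseteq> {0<..}"
      using assms(1) by (auto simp: open_ray_cone_eq future_cone_def)
    show "Ck_on k (open_ray_cone \<Omega>) (\<lambda>x. - lorentz x x \<bullet> i)" if "i \<in> Basis" for i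
      using that s[of "open_ray_cone \<Omega>"] by simp
  qed
  then have "Ck_on k (open_ray_cone \<Omega>) (\<lambda>x. (- lorentz x x) powr (-1/2) * (fst x \<bullet> i))"
    by (rule Ck_on_mult[OF _ lin(1)])
  then show "Ck_on k (open_ray_cone \<Omega>) (\<lambda>x. fst (hyp_proj x) \<bullet> i)"
    by (simp add: hyp_proj_def)
qed

section \<open>Functions homogeneous of degree 0\<close>

text \<open>Along the line through \<open>q\<close> in direction \<open>v\<close> the first
  derivative is zero at \<open>q\<close>. A positive second derivative would make it positive just
  to the right, and the mean value theorem would give a value above the maximum.\<close>

lemma second_derivative_test_max:
  fixes f :: "'a::real_normed_vector \<Rightarrow> real"
  assumes S: "open S" "q \<in> S"
    and max: "\<And>x. x \<in> S \<Longrightarrow> f x \<le> f q"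
    and f': "\<And>x. x \<in> S \<Longrightarrow> (f has_derivative f' x) (at x)"
    and f'': "((\<lambda>x. f' x v) has_derivative f'') (at q)"
  shows "f'' v \<le> 0"
proof (rule ccontr)
  assume "\<not> f'' v \<le> 0"
  then have pos: "f'' v > 0" by simp
  have line: "((\<lambda>t. q + t *\<^sub>R v) has_derivative (\<lambda>t. t *\<^sub>R v)) (at t)" for t
    by (auto intro!: derivative_eq_intros)
  have comp: "((\<lambda>t. h (q + t *\<^sub>R v)) has_real_derivative h' v) (at t)"
    if "(h has_derivative h') (at (q + t *\<^sub>R v))" for h :: "'a \<Rightarrow> real" and h' t
  proof -
    have "((\<lambda>t. h (q + t *\<^sub>R v)) has_derivative (\<lambda>t. h' (t *\<^sub>R v))) (at t)"
      by (rule has_derivative_compose[OF line that])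
    then show ?thesis
      unfolding has_field_derivative_def
      by (rule has_derivative_eq_rhs)
         (use has_derivative_linear[OF that] in \<open>simp add: fun_eq_iff linear_cmul mult.commute\<close>)
  qed
  have "open ((\<lambda>t. q + t *\<^sub>R v) -` S)"
    using S(1) by (intro continuous_open_vimage) (auto intro!: continuous_intros)
  moreover have "0 \<in> (\<lambda>t. q + t *\<^sub>R v) -` S"
    using S by simp
  ultimately obtain e where e: "e > 0" "ball 0 e \<subseteq> (\<lambda>t. q + t *\<^sub>R v) -` S"
    by (meson openE)
  then have inS: "q + t *\<^sub>R v \<in> S" if "\<bar>t\<bar> < e" for t
    using that by (auto simp: dist_norm)
  have r': "((\<lambda>t. f (q + t *\<^sub>R v)) has_real_derivative f' (q + t *\<^sub>R v) v) (at t)" if "\<bar>t\<bar> < e" for t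
    by (rule comp[OF f'[OF inS[OF that]]])
  have r'': "((\<lambda>t. f' (q + t *\<^sub>R v) v) has_real_derivative f'' v) (at 0)"
    by (rule comp) (use f'' in simp)
  have r0: "f' q v = 0"
  proof -
    have "((\<lambda>t. f (q + t *\<^sub>R v)) has_real_derivative f' q v) (at 0)"
      using r'[of 0] e by simp
    then show ?thesis
      by (rule DERIV_local_max[OF _ e(1)]) (use max inS in auto)
  qed
  obtain d where d: "d > 0" "\<And>h. 0 < h \<Longrightarrow> h < d \<Longrightarrow> f' q v < f' (q + h *\<^sub>R v) v"
    using DERIV_pos_inc_right[OF r'' pos] by auto
  define t where "t = min d e / 2"
  have t: "0 < t" "t < d" "t < e"
    using d e by (auto simp: t_def min_def)
  have "\<exists>z. 0 < z \<and> z < t \<and> f (q + t *\<^sub>R v) - f (q + 0 *\<^sub>R v) = (t - 0) * f' (q + z *\<^sub>R v) v"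
    by (rule MVT2[OF t(1)]) (use r' t in auto)
  then obtain z where z: "0 < z" "z < t" "f (q + t *\<^sub>R v) - f q = t * f' (q + z *\<^sub>R v) v"
    by auto
  have "0 < f' (q + z *\<^sub>R v) v"
    using d(2)[of z] z t r0 by simp
  then have "f q < f (q + t *\<^sub>R v)"
    using z t mult_pos_pos[of t "f' (q + z *\<^sub>R v) v"] by linarith
  moreover have "f (q + t *\<^sub>R v) \<le> f q"
    using max inS t by simp
  ultimately show False by simp
qed

text \<open>Differentiability of the operator is known only after evaluation at each fixed vector;
  expanding \<open>g x\<close> in the finite basis suffices for the product rule.\<close>

lemma has_derivative_linear_apply:
  fixes A :: "'a::real_normed_vector \<Rightarrow> 'b::euclidean_space \<Rightarrow> 'c::real_normed_vector"
  assumes S: "open S" "q \<in> S"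
    and lin: "\<And>x. x \<in> S \<Longrightarrow> linear (A x)" "\<And>w. linear (B w)"
    and A: "\<And>v. ((\<lambda>x. A x v) has_derivative (\<lambda>w. B w v)) (at q)"
    and g: "(g has_derivative g') (at q)"
  shows "((\<lambda>x. A x (g x)) has_derivative (\<lambda>w. B w (g q) + A q (g' w))) (at q)"
proof -
  have expand: "L v = (\<Sum>b\<in>Basis. (v \<bullet> b) *\<^sub>R L b)" if "linear L" for L :: "'b \<Rightarrow> 'c" and v
  proof -
    have "L v = L (\<Sum>b\<in>Basis. (v \<bullet> b) *\<^sub>R b)"
      by (simp only: euclidean_representation)
    then show ?thesis
      by (simp only: linear_sum[OF that] linear_cmul[OF that])
  qed
  have "((\<lambda>x. \<Sum>b\<in>Basis. (g x \<bullet> b) *\<^sub>R A x b) has_derivative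
      (\<lambda>w. \<Sum>b\<in>Basis. ((g q \<bullet> b) *\<^sub>R B w b + (g' w \<bullet> b) *\<^sub>R A q b))) (at q)"
    by (intro has_derivative_sum has_derivative_scaleR A has_derivative_inner_left g)
  also have "(\<lambda>w. \<Sum>b\<in>Basis. ((g q \<bullet> b) *\<^sub>R B w b + (g' w \<bullet> b) *\<^sub>R A q b))
      = (\<lambda>w. B w (g q) + A q (g' w))"
    unfolding sum.distrib expand[OF lin(2), symmetric] expand[OF lin(1)[OF S(2)], symmetric] ..
  finally show ?thesis
    by (rule has_derivative_transform_within_open[OF _ S]) (simp add: expand[OF lin(1), symmetric])
qed

lemma sum_lorentz_flip: "(\<Sum>b\<in>Basis. lorentz b (flip_time (b :: ('n::finite) mink))) = real CARD('n) + 1"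
  by (simp add: lorentz_flip_time)

text \<open>\<open>B x w v\<close> is the derivative of \<open>A x v\<close> in direction
  \<open>w\<close>, and \<open>radial\<close> is Euler's relation for degree 0.\<close>

locale degree_zero_C3 =
  fixes S :: "('n::finite) mink set" and U :: "'n mink \<Rightarrow> real" and gr :: "'n mink \<Rightarrow> 'n mink"
    and A :: "'n mink \<Rightarrow> 'n mink \<Rightarrow> 'n mink" and B :: "'n mink \<Rightarrow> 'n mink \<Rightarrow> 'n mink \<Rightarrow> 'n mink"
  assumes open_S: "open S"
    and U_deriv: "x \<in> S \<Longrightarrow> (U has_derivative lorentz (gr x)) (at x)"
    and gr_deriv: "x \<in> S \<Longrightarrow> (gr has_derivative A x) (at x)"
    and A_deriv: "x \<in> S \<Longrightarrow> ((\<lambda>y. A y v) has_derivative (\<lambda>w. B x w v)) (at x)"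
    and A_sym: "x \<in> S \<Longrightarrow> lorentz (A x v) w = lorentz v (A x w)"
    and B_sym: "x \<in> S \<Longrightarrow> B x w v = B x v w"
    and radial: "x \<in> S \<Longrightarrow> lorentz (gr x) x = 0"
begin

lemma linear_A: "x \<in> S \<Longrightarrow> linear (A x)"
  using gr_deriv has_derivative_linear by blast

lemma linear_B:
  assumes "x \<in> S"
  shows "linear (\<lambda>w. B x w v)" "linear (B x w)"
proof -
  show *: "linear (\<lambda>w. B x w v)" for v
    using A_deriv[OF assms] has_derivative_linear by blast
  have "(\<lambda>v. B x v w) = B x w"
    by (rule ext) (rule B_sym[OF assms])
  with *[of w] show "linear (B x w)"
    by (rule back_subst)
qed

lemma B_lorentz_sym:
  assumes "x \<in> S"
  shows "lorentz (B x z v) w = lorentz v (B x z w)"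
proof -
  have 1: "((\<lambda>y. lorentz (A y v) w) has_derivative (\<lambda>z. lorentz (A x v) 0 + lorentz (B x z v) w)) (at x)"
    by (intro lorentz.FDERIV A_deriv assms has_derivative_const)
  have 2: "((\<lambda>y. lorentz v (A y w)) has_derivative (\<lambda>z. lorentz v (B x z w) + lorentz 0 (A x w))) (at x)"
    by (intro lorentz.FDERIV A_deriv assms has_derivative_const)
  have "((\<lambda>y. lorentz v (A y w)) has_derivative (\<lambda>z. lorentz (A x v) 0 + lorentz (B x z v) w)) (at x)"
    using 1 by (rule has_derivative_transform_within_open[OF _ open_S assms]) (rule A_sym)
  from fun_cong[OF has_derivative_unique[OF this 2], of z] show ?thesis
    by (simp add: lorentz.zero_left lorentz.zero_right)
qed

text \<open>Differentiated Euler relation: the gradient is homogeneous of degree -1.\<close>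

lemma A_radial:
  assumes x: "x \<in> S"
  shows "A x x = - gr x"
proof -
  have "((\<lambda>y. lorentz (gr y) y) has_derivative (\<lambda>v. lorentz (gr x) v + lorentz (A x v) x)) (at x)"
    by (intro lorentz.FDERIV gr_deriv x has_derivative_ident)
  then have "((\<lambda>y. 0) has_derivative (\<lambda>v. lorentz (gr x) v + lorentz (A x v) x)) (at x)"
    by (rule has_derivative_transform_within_open[OF _ open_S x]) (rule radial)
  then have *: "(\<lambda>v. lorentz (gr x) v + lorentz (A x v) x) = (\<lambda>v. 0)"
    using has_derivative_unique has_derivative_const by blast
  have "lorentz (A x x + gr x) v = 0" for v
    using fun_cong[OF *, of v] A_sym[OF x, of v x]
    by (simp add: lorentz.add_left lorentz_commute[of v])
  then have "A x x + gr x = 0"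
    by (rule lorentz_nondegenerate)
  then show ?thesis
    by (simp add: eq_neg_iff_add_eq_0)
qed

text \<open>The same one order higher: the Hessian has degree -2.\<close>

lemma B_radial:
  assumes x: "x \<in> S"
  shows "B x w x = - 2 *\<^sub>R A x w"
proof -
  have "((\<lambda>y. A y y) has_derivative (\<lambda>w. B x w x + A x w)) (at x)"
    using has_derivative_linear_apply[OF open_S x linear_A linear_B(2)[OF x] A_deriv[OF x] has_derivative_ident] .
  then have "((\<lambda>y. - gr y) has_derivative (\<lambda>w. B x w x + A x w)) (at x)"
    by (rule has_derivative_transform_within_open[OF _ open_S x]) (rule A_radial)
  moreover have "((\<lambda>y. - gr y) has_derivative (\<lambda>w. - A x w)) (at x)"
    by (intro has_derivative_minus gr_deriv x)
  ultimately have "(\<lambda>w. B x w x + A x w) = (\<lambda>w. - A x w)"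
    by (rule has_derivative_unique)
  from fun_cong[OF this, of w] have "B x w x = - A x w - A x w"
    by (simp add: eq_diff_eq)
  also have "\<dots> = - 2 *\<^sub>R A x w"
    by (metis (no_types, opaque_lifting) diff_minus_eq_add minus_diff_eq mult_minus1 scaleR_2 scaleR_minus_left)
  finally show ?thesis .
qed

section \<open>The squared gradient norm, its Hessian, and the left-hand side of the
  equation\<close>

definition P :: "'n mink \<Rightarrow> real" where
  "P x = - lorentz x x * lorentz (gr x) (gr x)"

definition dP :: "'n mink \<Rightarrow> 'n mink \<Rightarrow> real" where
  "dP x v = - 2 * lorentz x v * lorentz (gr x) (gr x) - 2 * lorentz x x * lorentz (A x v) (gr x)"

definition d2P :: "'n mink \<Rightarrow> 'n mink \<Rightarrow> 'n mink \<Rightarrow> real" where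
  "d2P x v w = - 2 * (lorentz w v * lorentz (gr x) (gr x) + 2 * lorentz x v * lorentz (A x w) (gr x))
     - 2 * (2 * lorentz x w * lorentz (A x v) (gr x)
        + lorentz x x * (lorentz (B x w v) (gr x) + lorentz (A x v) (A x w)))"

lemma gr_gr_deriv:
  assumes "x \<in> S"
  shows "((\<lambda>y. lorentz (gr y) (gr y)) has_derivative (\<lambda>v. 2 * lorentz (A x v) (gr x))) (at x)"
  by (rule has_derivative_eq_rhs[OF lorentz.FDERIV[OF gr_deriv[OF assms] gr_deriv[OF assms]]])
     (simp add: fun_eq_iff lorentz_commute)

lemma lorentz_self_deriv: "((\<lambda>y. lorentz y y) has_derivative (\<lambda>v. 2 * lorentz x v)) (at x)"
  by (rule has_derivative_eq_rhs[OF lorentz.FDERIV[OF has_derivative_ident has_derivative_ident]])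
     (simp add: fun_eq_iff lorentz_commute)

lemma lorentz_left_deriv: "((\<lambda>y. lorentz y v) has_derivative (\<lambda>w. lorentz w v)) (at x)"
  by (rule bounded_linear_imp_has_derivative[OF lorentz.bounded_linear_left])

lemma P_deriv:
  assumes "x \<in> S"
  shows "(P has_derivative dP x) (at x)"
  unfolding P_def[abs_def]
  by (rule has_derivative_eq_rhs[OF has_derivative_mult[OF has_derivative_minus[OF lorentz_self_deriv]
          gr_gr_deriv[OF assms]]])
     (simp add: fun_eq_iff dP_def)

lemma dP_deriv:
  assumes "x \<in> S"
  shows "((\<lambda>y. dP y v) has_derivative d2P x v) (at x)"
proof -
  have Av: "((\<lambda>y. lorentz (A y v) (gr y)) has_derivative
      (\<lambda>w. lorentz (A x v) (A x w) + lorentz (B x w v) (gr x))) (at x)"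
    by (intro lorentz.FDERIV A_deriv gr_deriv assms)
  have "((\<lambda>y. (- 2) * (lorentz y v * lorentz (gr y) (gr y)) - 2 * (lorentz y y * lorentz (A y v) (gr y)))
     has_derivative (\<lambda>w. (- 2) * (lorentz x v * (2 * lorentz (A x w) (gr x)) + lorentz w v * lorentz (gr x) (gr x))
       - 2 * (lorentz x x * (lorentz (A x v) (A x w) + lorentz (B x w v) (gr x))
           + 2 * lorentz x w * lorentz (A x v) (gr x)))) (at x)"
    by (intro has_derivative_diff has_derivative_mult_right has_derivative_mult lorentz_left_deriv
        gr_gr_deriv assms Av lorentz_self_deriv)
  then have "((\<lambda>y. (- 2) * (lorentz y v * lorentz (gr y) (gr y)) - 2 * (lorentz y y * lorentz (A y v) (gr y)))
     has_derivative d2P x v) (at x)"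
    by (rule has_derivative_eq_rhs) (simp add: fun_eq_iff d2P_def algebra_simps)
  then show ?thesis
    by (simp add: dP_def mult.assoc)
qed

lemma bilinear_d2P:
  assumes "x \<in> S"
  shows "bilinear (d2P x)"
proof -
  note [simp] = linear_add[OF linear_A[OF assms]] linear_cmul[OF linear_A[OF assms]]
    linear_add[OF linear_B(1)[OF assms]] linear_cmul[OF linear_B(1)[OF assms]]
    linear_add[OF linear_B(2)[OF assms]] linear_cmul[OF linear_B(2)[OF assms]]
    lorentz.add_left lorentz.add_right lorentz.scaleR_left lorentz.scaleR_right
  show ?thesis
    unfolding bilinear_def linear_iff d2P_def by (simp add: algebra_simps)
qed

text \<open>On the hyperboloid this is \<open>(1 - P) powr (3/2)\<close> times the divergence in the equation.\<close>

definition Q :: "'n mink \<Rightarrow> real" where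
  "Q x = (1 - P x) * op_trace (A x) - lorentz x x * lorentz (A x (gr x)) (gr x)"

lemma Q_deriv:
  assumes "x \<in> S"
  shows "(Q has_derivative (\<lambda>w. (1 - P x) * op_trace (B x w) - dP x w * op_trace (A x)
    - (lorentz x x * (lorentz (B x w (gr x)) (gr x) + 2 * lorentz (A x w) (A x (gr x)))
      + 2 * lorentz x w * lorentz (A x (gr x)) (gr x)))) (at x)"
proof -
  have 1: "((\<lambda>y. op_trace (A y)) has_derivative (\<lambda>w. op_trace (B x w))) (at x)"
  proof -
    have "((\<lambda>y. lorentz (A y b) (flip_time b)) has_derivative (\<lambda>w. lorentz (B x w b) (flip_time b))) (at x)" for b
      by (rule has_derivative_eq_rhs[OF lorentz.FDERIV[OF A_deriv[OF assms] has_derivative_const]])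
         (simp add: lorentz.zero_right)
    then show ?thesis
      unfolding op_trace_def by (intro has_derivative_sum)
  qed
  have "((\<lambda>y. A y (gr y)) has_derivative (\<lambda>w. B x w (gr x) + A x (A x w))) (at x)"
    by (rule has_derivative_linear_apply[OF open_S assms linear_A linear_B(2)[OF assms] A_deriv[OF assms] gr_deriv[OF assms]])
  from lorentz.FDERIV[OF this gr_deriv[OF assms]]
  have 2: "((\<lambda>y. lorentz (A y (gr y)) (gr y)) has_derivative
      (\<lambda>w. lorentz (B x w (gr x)) (gr x) + 2 * lorentz (A x w) (A x (gr x)))) (at x)"
    by (rule has_derivative_eq_rhs)
       (rule ext, simp add: lorentz.add_left A_sym[OF assms, of "A x w" "gr x" for w]
         lorentz_commute[of "A x (gr x)" "A x w" for w])
  have 3: "((\<lambda>y. 1 - P y) has_derivative (\<lambda>w. - dP x w)) (at x)"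
    by (rule has_derivative_eq_rhs[OF has_derivative_diff[OF has_derivative_const P_deriv[OF assms]]]) simp
  show ?thesis
    unfolding Q_def[abs_def]
    by (rule has_derivative_eq_rhs[OF has_derivative_diff[OF has_derivative_mult[OF 3 1] has_derivative_mult[OF lorentz_self_deriv 2]]])
       (simp add: fun_eq_iff algebra_simps)
qed

text \<open>The Bochner inequality. The ambient trace of the form gives \<open>- 2 * (n + 1)\<close>
  times \<open>P\<close>, the cross terms from differentiating \<open>lorentz x x\<close> give 8,
  and the square of the Hessian, bounded below by \<open>op_trace_square_ge\<close>, costs 4:
  together \<open>- 2 * (n - 1)\<close>.\<close>

lemma bilin_trace_d2P:
  assumes q: "q \<in> S" "q \<in> hyp_space"
  shows "bilin_trace (d2P q) \<ge> - 2 * (real CARD('n) - 1) * P q + 2 * op_trace (B q (gr q))"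
proof -
  define g where "g = gr q"
  have qq: "lorentz q q = -1"
    using q lorentz_hyp_space by blast
  have P: "P q = lorentz g g"
    by (simp add: P_def qq g_def)
  have Aqg: "A q q = - g" and qg: "lorentz g q = 0" "lorentz q g = 0"
    using A_radial radial q by (auto simp: g_def lorentz_commute[of q])
  have J: "(\<Sum>b\<in>Basis. lorentz v b * lorentz w (flip_time b)) = lorentz v w" for v w
  proof -
    have "lorentz w (\<Sum>b\<in>Basis. lorentz v b *\<^sub>R flip_time b) = (\<Sum>b\<in>Basis. lorentz v b * lorentz w (flip_time b))"
      by (simp add: lorentz.sum_right lorentz.scaleR_right)
    then show ?thesis
      by (simp only: flip_time_expansion lorentz_commute[of w v])
  qed
  have t: "d2P q b c = - 2 * P q * lorentz b c - 4 * (lorentz q b * lorentz (A q g) c)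
      - 4 * (lorentz q c * lorentz (A q g) b) + 2 * lorentz (B q g b) c + 2 * lorentz (A q (A q b)) c" for b c
  proof -
    have "lorentz (A q c) g = lorentz (A q g) c" "lorentz (A q b) g = lorentz (A q g) b"
      using A_sym[OF q(1), of c g] A_sym[OF q(1), of b g]
      by (simp_all add: lorentz_commute[of _ "A q g"])
    moreover have "lorentz (B q c b) g = lorentz (B q g b) c"
      using B_lorentz_sym[OF q(1), of b c g]
      by (simp add: B_sym[OF q(1), of c b] B_sym[OF q(1), of g b] lorentz_commute)
    moreover have "lorentz (A q b) (A q c) = lorentz (A q (A q b)) c"
      by (rule A_sym[OF q(1), symmetric])
    ultimately show ?thesis
      unfolding d2P_def P qq g_def[symmetric] by (simp add: lorentz_commute[of c b])
  qed
  have "bilin_trace (d2P q) = - 2 * P q * (\<Sum>b\<in>Basis. lorentz b (flip_time (b::'n mink)))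
     - 4 * (\<Sum>b\<in>Basis. lorentz q b * lorentz (A q g) (flip_time b))
     - 4 * (\<Sum>b\<in>Basis. lorentz (A q g) b * lorentz q (flip_time b))
     + 2 * op_trace (B q g) + 2 * op_trace (\<lambda>v. A q (A q v))"
    unfolding bilin_trace_def t op_trace_def
    by (simp add: sum.distrib sum_subtractf sum_distrib_left sum_negf mult.commute)
  also have "\<dots> = - 2 * P q * (real CARD('n) + 1) - 4 * lorentz q (A q g) - 4 * lorentz (A q g) q
     + 2 * op_trace (B q g) + 2 * op_trace (\<lambda>v. A q (A q v))"
    unfolding J sum_lorentz_flip ..
  also have "lorentz (A q g) q = - P q"
    unfolding A_sym[OF q(1)] Aqg P by (rule lorentz.minus_right)
  also have "lorentz q (A q g) = - P q"
    unfolding A_sym[OF q(1), symmetric] Aqg P by (rule lorentz.minus_left)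
  finally have "bilin_trace (d2P q) = - 2 * P q * (real CARD('n) + 1) + 8 * P q + 2 * op_trace (B q g) + 2 * op_trace (\<lambda>v. A q (A q v))"
    by simp
  moreover have "op_trace (\<lambda>v. A q (A q v)) \<ge> - 2 * P q"
    using op_trace_square_ge[OF q(2) linear_A[OF q(1)] A_sym[OF q(1)]]
    by (simp add: Aqg lorentz.minus_left lorentz.minus_right qg P)
  ultimately show ?thesis
    by (simp add: g_def algebra_simps)
qed

text \<open>\<open>P\<close> is constant along rays, so its second derivative along the ray
  vanishes.\<close>

lemma d2P_radial:
  assumes q: "q \<in> S" "q \<in> hyp_space"
  shows "d2P q q q = 0"
  using q
  by (simp add: d2P_def lorentz_hyp_space A_radial B_radial lorentz.minus_left lorentz.minus_right
      lorentz.scaleR_left)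

end

section \<open>The inequality at an interior maximum\<close>

lemma exp_square_deriv:
  fixes f :: "'a::real_normed_vector \<Rightarrow> real"
  assumes "(f has_derivative f') (at x)"
  shows "((\<lambda>y. m * exp (n * (f y)\<^sup>2)) has_derivative
      (\<lambda>v. (2 * n * f x * (m * exp (n * (f x)\<^sup>2))) * f' v)) (at x)" (is ?A)
    and "((\<lambda>y. 2 * n * f y * (m * exp (n * (f y)\<^sup>2))) has_derivative
      (\<lambda>v. (2 * n + (2 * n * f x)\<^sup>2) * (m * exp (n * (f x)\<^sup>2)) * f' v)) (at x)" (is ?B)
proof -
  have chain: "((\<lambda>y. h (f y)) has_derivative (\<lambda>v. h' * f' v)) (at x)"
    if "(h has_real_derivative h') (at (f x))" for h h'
    using has_derivative_compose[OF assms that[unfolded has_field_derivative_def]] .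
  show ?A
    by (rule chain[where h = "\<lambda>r. m * exp (n * r\<^sup>2)"])
       (auto intro!: derivative_eq_intros simp: algebra_simps)
  show ?B
    by (rule chain[where h = "\<lambda>r. 2 * n * r * (m * exp (n * r\<^sup>2))"])
       (auto intro!: derivative_eq_intros simp: algebra_simps power2_eq_square)
qed

text \<open>Needed because both sides of the equation are known to agree on \<Omega> only, not on
  the cone; hence just their tangential derivatives may be compared.\<close>

lemma hyp_derivative_eq_on:
  assumes \<Omega>: "openin (top_of_set hyp_space) \<Omega>" and q: "q \<in> \<Omega>"
    and f: "(f has_derivative f') (at q)" and g: "(g has_derivative g') (at q)"
    and eq: "\<And>x. x \<in> \<Omega> \<Longrightarrow> f x = g x" and v: "v \<in> hyp_tangent q"
  shows "f' v = g' v"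
proof -
  have qh: "q \<in> hyp_space"
    using \<Omega> q openin_imp_subset by blast
  obtain d where d: "d > 0" "ball q d \<inter> hyp_space \<subseteq> \<Omega>"
    using \<Omega> q unfolding openin_contains_ball by blast
  have "(g has_derivative f') (at q within hyp_space)"
    by (rule has_derivative_transform_within[OF has_derivative_at_withinI[OF f] d(1) qh])
       (use eq d in \<open>auto simp: dist_commute\<close>)
  then show ?thesis
    using hyp_derivative_unique[OF qh v _ has_derivative_at_withinI[OF g]] by blast
qed

text \<open>Vanishing of the first derivative determines \<open>A q (gr q)\<close> completely. The
  Hessian inequality, contracted with the two parts of the coefficient matrix, then contains third
  derivatives only in the combination supplied by the differentiated equation.\<close>

lemma (in degree_zero_C3)
  fixes m :: real and R :: "'n mink \<Rightarrow> real"
  defines "n \<equiv> real CARD('n)"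
  assumes \<Omega>: "openin (top_of_set hyp_space) \<Omega>" "q \<in> \<Omega>" "q \<in> S"
    and eq: "\<And>x. x \<in> \<Omega> \<Longrightarrow> Q x = R x" and R': "(R has_derivative R') (at q)"
    and max: "\<And>x. x \<in> S \<Longrightarrow> P x + m * exp (n * (U x)\<^sup>2) \<le> P q + m * exp (n * (U q)\<^sup>2)"
    and m: "m * exp (n * (U q)\<^sup>2) = 1 - P q" and P1: "P q < 1"
  shows interior_max_gradient: "dP q v = - (2 * (n * U q) * (1 - P q)) * lorentz (gr q) v"
    and interior_max_inequality:
      "2 * (1 - P q) * P q + 2 * (n * U q)\<^sup>2 * (1 - P q)\<^sup>2 * P q + 2 * (n * U q) * (1 - P q) * R q
      - 4 * (n * U q) * P q * R q + 2 * R' (gr q) \<le> 0"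
proof -
  have qh: "q \<in> hyp_space"
    using \<Omega> openin_imp_subset by blast
  have qq: "lorentz q q = -1"
    using qh lorentz_hyp_space by blast
  define g a p \<delta> \<phi> where "g = gr q" and "a = A q" and "p = P q" and "\<delta> = 1 - p" and "\<phi> = n * U q"
  have \<delta>: "\<delta> > 0"
    using P1 by (simp add: \<delta>_def p_def)
  have qg: "lorentz g q = 0" "lorentz q g = 0"
    using radial[OF \<Omega>(3)] by (auto simp: g_def lorentz_commute[of q])
  have p: "lorentz g g = p"
    by (simp add: p_def P_def qq g_def)
  have aq: "a q = - g"
    using A_radial[OF \<Omega>(3)] by (simp add: a_def g_def)
  have asym: "lorentz (a v) w = lorentz v (a w)" for v w
    using A_sym[OF \<Omega>(3)] by (simp add: a_def)
  \<comment> \<open>\<open>c\<close> and \<open>d\<close> are the coefficients of the Hessian of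
    \<open>U\<close> and of the square of its differential in the second derivative of
    \<open>m * exp (n * U\<^sup>2)\<close> at \<open>q\<close>, with \<open>m\<close> eliminated by
    its defining equation.\<close>
  define c where "c = 2 * \<phi> * \<delta>"
  define d where "d = (2 * n + 4 * \<phi>\<^sup>2) * \<delta>"
  define F where "F x v = dP x v + (2 * n * U x * (m * exp (n * (U x)\<^sup>2))) * lorentz (gr x) v" for x v
  define M where "M v w = d2P q v w + (c * lorentz (a w) v + d * lorentz g w * lorentz g v)" for v w
  have F: "((\<lambda>x. P x + m * exp (n * (U x)\<^sup>2)) has_derivative F x) (at x)" if "x \<in> S" for x
    unfolding F_def by (intro has_derivative_add P_deriv exp_square_deriv(1) U_deriv that)
  have M: "((\<lambda>x. F x v) has_derivative M v) (at q)" for v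
  proof -
    have 1: "((\<lambda>x. lorentz (gr x) v) has_derivative (\<lambda>w. lorentz (a w) v)) (at q)"
      by (rule has_derivative_eq_rhs[OF lorentz.FDERIV[OF gr_deriv[OF \<Omega>(3)] has_derivative_const]])
         (simp add: lorentz.zero_right a_def)
    have "((\<lambda>x. F x v) has_derivative (\<lambda>w. d2P q v w +
       ((2 * n * U q * (m * exp (n * (U q)\<^sup>2))) * lorentz (a w) v
         + (2 * n + (2 * n * U q)\<^sup>2) * (m * exp (n * (U q)\<^sup>2)) * lorentz g w * lorentz (gr q) v))) (at q)"
      unfolding F_def g_def
      by (intro has_derivative_add dP_deriv has_derivative_mult exp_square_deriv(2) U_deriv \<Omega>(3) 1)
    then show ?thesis
      unfolding M_def c_def d_def m \<delta>_def p_def \<phi>_def g_def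
      by (simp add: power_mult_distrib mult.assoc mult.left_commute)
  qed
  have M_nonpos: "M v v \<le> 0" for v
    by (rule second_derivative_test_max[OF open_S \<Omega>(3) max F M])
  have F0: "F q v = 0" for v
  proof -
    have "F q = (\<lambda>v. 0)"
      by (rule differential_zero_maxmin[OF \<Omega>(3) open_S F[OF \<Omega>(3)]]) (use max in auto)
    then show ?thesis by simp
  qed
  have dP: "dP q v = - c * lorentz g v" for v
    using F0[of v] unfolding F_def m c_def \<delta>_def p_def \<phi>_def g_def by simp
  from dP show "dP q v = - (2 * (n * U q) * (1 - P q)) * lorentz (gr q) v"
    unfolding c_def \<phi>_def \<delta>_def p_def g_def .
  have dPa: "dP q v = - 2 * lorentz q v * p + 2 * lorentz v (a g)" for v
    using A_sym[OF \<Omega>(3), of v g] by (simp add: dP_def qq p[unfolded g_def] g_def a_def)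
  \<comment> \<open>Equates the critical point condition \<open>dP\<close> with the explicit
    differential \<open>dPa\<close> and solves for \<open>a g\<close>.\<close>
  have "lorentz (a g - (p *\<^sub>R q - (c / 2) *\<^sub>R g)) v = 0" for v
    using dP[of v] dPa[of v]
    unfolding lorentz.diff_left lorentz.scaleR_left lorentz_commute[of v] real_scaleR_def by argo
  then have "a g - (p *\<^sub>R q - (c / 2) *\<^sub>R g) = 0"
    by (rule lorentz_nondegenerate)
  then have ag: "a g = p *\<^sub>R q - (c / 2) *\<^sub>R g"
    by simp
  have agg: "lorentz (a g) g = - c * p / 2"
    by (simp add: ag lorentz.diff_left lorentz.scaleR_left qg p)
  have agag: "lorentz (a g) (a g) = - p\<^sup>2 + c\<^sup>2 * p / 4"
    by (simp add: ag lorentz.diff_left lorentz.diff_right lorentz.scaleR_left lorentz.scaleR_right qg p qq power2_eq_square)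
  define tr T3 b3 where "tr = op_trace a" and "T3 = op_trace (B q g)" and "b3 = lorentz (B q g g) g"
  have eq0: "\<delta> * tr = R q + c * p / 2"
    using eq[OF \<Omega>(2)] agg by (simp add: Q_def qq \<delta>_def p_def tr_def a_def g_def)
  have g_tang: "g \<in> hyp_tangent q"
    by (simp add: hyp_tangent_def qg)
  \<comment> \<open>The differentiated equation in the direction of the gradient, which is
    tangent.\<close>
  have "\<delta> * T3 - dP q g * tr + (b3 + 2 * lorentz (a g) (a g)) = R' g"
    using hyp_derivative_eq_on[OF \<Omega>(1,2) Q_deriv[OF \<Omega>(3)] R' eq g_tang]
    by (simp add: qq qg[unfolded g_def] \<delta>_def p_def tr_def a_def g_def T3_def b3_def)
  then have eq1: "\<delta> * T3 + b3 = R' g - c * p * tr - 2 * lorentz (a g) (a g)"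
    by (simp add: dP p)
  have bil: "bilinear M"
  proof -
    have [simp]: "linear a"
      using linear_A[OF \<Omega>(3)] by (simp add: a_def)
    have "bilinear (\<lambda>v w. c * lorentz (a w) v + d * lorentz g w * lorentz g v)"
      unfolding bilinear_def linear_iff
      by (simp add: linear_add linear_cmul lorentz.add_left lorentz.add_right lorentz.scaleR_left
          lorentz.scaleR_right algebra_simps)
    with bilinear_d2P[OF \<Omega>(3)] show ?thesis
      unfolding M_def[abs_def] bilinear_def by (auto intro: linear_compose_add)
  qed
  have "bilin_trace M = bilin_trace (d2P q) + c * tr + d * p"
  proof -
    have J: "(\<Sum>b\<in>Basis. lorentz g (flip_time b) * lorentz g b) = lorentz g g"
    proof -
      have "lorentz g (\<Sum>b\<in>Basis. lorentz g b *\<^sub>R flip_time b) = (\<Sum>b\<in>Basis. lorentz g (flip_time b) * lorentz g b)"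
        by (simp add: lorentz.sum_right lorentz.scaleR_right mult.commute)
      then show ?thesis
        by (simp only: flip_time_expansion)
    qed
    have "bilin_trace M = bilin_trace (d2P q) + (c * (\<Sum>b\<in>Basis. lorentz (a (flip_time b)) b)
        + d * (\<Sum>b\<in>Basis. lorentz g (flip_time b) * lorentz g b))"
      by (simp add: bilin_trace_def M_def sum.distrib sum_distrib_left mult.assoc)
    also have "(\<Sum>b\<in>Basis. lorentz (a (flip_time b)) b) = tr"
      unfolding tr_def op_trace_def by (intro sum.cong refl) (simp add: asym lorentz_commute[of "flip_time _"])
    finally show ?thesis
      by (simp only: J p add.assoc)
  qed
  \<comment> \<open>The radial direction contributes nothing, so the ambient trace itself is
    nonpositive.\<close>
  moreover have "M q q = 0"
    by (simp add: M_def d2P_radial[OF \<Omega>(3) qh] aq qg lorentz.minus_left)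
  ultimately have "bilin_trace (d2P q) + c * tr + d * p \<le> 0"
    using bilin_trace_nonpos[OF qh bil M_nonpos] by simp
  then have "- 2 * (n - 1) * p + 2 * T3 + c * tr + d * p \<le> 0"
    using bilin_trace_d2P[OF \<Omega>(3) qh] by (simp add: n_def p_def T3_def g_def)
  then have 1: "\<delta> * (- 2 * (n - 1) * p + 2 * T3 + c * tr + d * p) \<le> 0"
    using \<delta> by (simp add: mult_nonneg_nonpos)
  have "d2P q g g = - 2 * p\<^sup>2 + 2 * b3 + 2 * lorentz (a g) (a g)"
    by (simp add: d2P_def qq qg b3_def a_def p[unfolded g_def] g_def power2_eq_square)
       (simp add: p[unfolded g_def] qg[unfolded g_def])
  then have 2: "- 2 * p\<^sup>2 + 2 * b3 + 2 * lorentz (a g) (a g) + c * lorentz (a g) g + d * p\<^sup>2 \<le> 0"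
    using M_nonpos[of g] by (simp add: M_def p power2_eq_square)
  define r r' where "r = R q" and "r' = R' g"
  have trd: "\<delta> * tr = r + c * p / 2"
    using eq0 by (simp add: r_def)
  \<comment> \<open>Sum of the two contractions; the third derivatives now appear exactly as on the
    left of \<open>eq1\<close>.\<close>
  have "2 * (\<delta> * T3 + b3) - 2 * (n - 1) * p * \<delta> + c * (\<delta> * tr) + d * p * (\<delta> + p) - 2 * p\<^sup>2
      + 2 * lorentz (a g) (a g) + c * lorentz (a g) g \<le> 0"
    using 1 2 by (simp add: algebra_simps power2_eq_square)
  then have 3: "2 * (r' - c * p * tr - 2 * (- p\<^sup>2 + c\<^sup>2 * p / 4)) - 2 * (n - 1) * p * \<delta> + c * (r + c * p / 2)
      + d * p * (\<delta> + p) - 2 * p\<^sup>2 + 2 * (- p\<^sup>2 + c\<^sup>2 * p / 4) + c * (- c * p / 2) \<le> 0"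
    unfolding eq1 trd agag agg r'_def .
  have "c * p * tr = 2 * \<phi> * p * (\<delta> * tr)"
    by (simp add: c_def)
  also have "\<dots> = 2 * \<phi> * p * r + 2 * \<phi>\<^sup>2 * \<delta> * p\<^sup>2"
    unfolding trd c_def by (simp add: algebra_simps power2_eq_square)
  finally have cpt: "c * p * tr = 2 * \<phi> * p * r + 2 * \<phi>\<^sup>2 * \<delta> * p\<^sup>2" .
  have "\<delta> + p = 1"
    by (simp add: \<delta>_def)
  then have dp: "d * p * (\<delta> + p) = (2 * n + 4 * \<phi>\<^sup>2) * \<delta> * p"
    by (simp add: d_def)
  have "2 * r' - 4 * \<phi> * p * r - 4 * \<phi>\<^sup>2 * \<delta> * p\<^sup>2 - 2 * (n - 1) * p * \<delta> + c * r
      + (2 * n + 4 * \<phi>\<^sup>2) * \<delta> * p - c\<^sup>2 * p / 2 \<le> 0"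
    using 3 unfolding cpt dp by (simp add: algebra_simps power2_eq_square)
  \<comment> \<open>The quadratic terms in \<open>\<phi>\<close> combine, by
    \<open>1 - p = \<delta>\<close>, to a nonnegative one.\<close>
  moreover have "4 * \<phi>\<^sup>2 * \<delta> * p - 4 * \<phi>\<^sup>2 * \<delta> * p\<^sup>2 - c\<^sup>2 * p / 2 = 2 * \<phi>\<^sup>2 * \<delta>\<^sup>2 * p"
    unfolding c_def \<delta>_def by (simp add: field_simps power2_eq_square)
  ultimately have "2 * \<delta> * p + 2 * \<phi>\<^sup>2 * \<delta>\<^sup>2 * p + c * r - 4 * \<phi> * p * r + 2 * r' \<le> 0"
    by (simp add: algebra_simps)
  then show "2 * (1 - P q) * P q + 2 * (n * U q)\<^sup>2 * (1 - P q)\<^sup>2 * P q + 2 * (n * U q) * (1 - P q) * R q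
      - 4 * (n * U q) * P q * R q + 2 * R' (gr q) \<le> 0"
    by (simp add: \<delta>_def p_def \<phi>_def r_def r'_def c_def g_def)
qed

section \<open>The equation on the cone\<close>

lemma cone_ext_degree_zero_C3:
  fixes u :: "('n::finite) mink \<Rightarrow> real"
  assumes \<Omega>: "openin (top_of_set hyp_space) \<Omega>"
    and u: "Ck_on 3 (fst ` \<Omega>) (\<lambda>y. u (hyp_param y))"
  obtains gr A B where "degree_zero_C3 (open_ray_cone \<Omega>) (cone_ext u) gr A B"
proof -
  have sub: "\<Omega> \<subseteq> hyp_space"
    using \<Omega> openin_imp_subset by blast
  obtain gr A B where *:
    "\<And>x. x \<in> open_ray_cone \<Omega> \<Longrightarrow> (cone_ext u has_derivative lorentz (gr x)) (at x)"
    "\<And>x. x \<in> open_ray_cone \<Omega> \<Longrightarrow> (gr has_derivative A x) (at x)"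
    "\<And>x v. x \<in> open_ray_cone \<Omega> \<Longrightarrow> ((\<lambda>y. A y v) has_derivative (\<lambda>w. B x w v)) (at x)"
    "\<And>x v w. x \<in> open_ray_cone \<Omega> \<Longrightarrow> lorentz (A x v) w = lorentz v (A x w)"
    "\<And>x v w. x \<in> open_ray_cone \<Omega> \<Longrightarrow> B x w v = B x v w"
    by (rule Ck_on_lorentz_gradient[OF open_open_ray_cone[OF \<Omega>] Ck_on_cone_ext[OF sub u]])
       (rule that; assumption)
  have "lorentz (gr x) x = 0" if x: "x \<in> open_ray_cone \<Omega>" for x
  proof -
    have xf: "x \<in> future_cone"
      using x sub by (auto simp: open_ray_cone_eq)
    have "((\<lambda>t::real. t *\<^sub>R x) has_derivative (\<lambda>t. t *\<^sub>R x)) (at 1)"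
      by (intro has_derivative_scaleR_left has_derivative_ident)
    moreover have "(cone_ext u has_derivative lorentz (gr x)) (at (1 *\<^sub>R x))"
      using *(1)[OF x] by simp
    ultimately have 1: "((\<lambda>t. cone_ext u (t *\<^sub>R x)) has_derivative (\<lambda>t. lorentz (gr x) (t *\<^sub>R x))) (at 1)"
      by (rule has_derivative_compose)
    have 2: "((\<lambda>t. cone_ext u x) has_derivative (\<lambda>t. lorentz (gr x) (t *\<^sub>R x))) (at 1)"
      by (rule has_derivative_transform_within_open[OF 1, of "{0<..}"])
         (auto simp: cone_ext_scale xf)
    from fun_cong[OF has_derivative_unique[OF 2 has_derivative_const], of 1] show ?thesis
      by simp
  qed
  with * have "degree_zero_C3 (open_ray_cone \<Omega>) (cone_ext u) gr A B"
    by (intro degree_zero_C3.intro open_open_ray_cone[OF \<Omega>])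
  then show thesis
    by (rule that)
qed

locale hyp_C3 = degree_zero_C3 "open_ray_cone \<Omega>" "cone_ext u" gr A B
  for \<Omega> :: "('n::finite) mink set" and u gr A B +
  assumes openin_\<Omega>: "openin (top_of_set hyp_space) \<Omega>"
begin

lemma \<Omega>_subset: "\<Omega> \<subseteq> hyp_space" "\<Omega> \<subseteq> open_ray_cone \<Omega>"
proof -
  show sub: "\<Omega> \<subseteq> hyp_space"
    using openin_\<Omega> openin_imp_subset by blast
  then show "\<Omega> \<subseteq> open_ray_cone \<Omega>"
    using hyp_space_subset_future_cone by (auto simp: open_ray_cone_eq hyp_proj_id subset_iff)
qed

lemma gr_tangent: "q \<in> \<Omega> \<Longrightarrow> gr q \<in> hyp_tangent q"
  using radial[of q] \<Omega>_subset(2) by (auto simp: hyp_tangent_def lorentz_commute[of q])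

lemma hyp_grad_eq_gr:
  assumes q: "q \<in> \<Omega>"
  shows "hyp_grad u q = gr q"
proof (rule hyp_grad_eqI[OF _ gr_tangent[OF q]])
  show qh: "q \<in> hyp_space"
    using q \<Omega>_subset by auto
  have "(cone_ext u has_derivative lorentz (gr q)) (at q within hyp_space)"
    using U_deriv \<Omega>_subset(2) q by (blast intro: has_derivative_at_withinI)
  then show "(u has_derivative lorentz (gr q)) (at q within hyp_space)"
    by (rule has_derivative_transform[rotated 2]) (auto simp: qh cone_ext_hyp_space)
qed simp

lemma P_eq:
  assumes q: "q \<in> \<Omega>"
  shows "P q = lorentz (gr q) (gr q)" "0 \<le> P q" "(hyp_norm (hyp_grad u q))\<^sup>2 = P q"
proof -
  have qh: "q \<in> hyp_space"
    using q \<Omega>_subset by auto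
  then show *: "P q = lorentz (gr q) (gr q)"
    by (simp add: P_def lorentz_hyp_space)
  then show "0 \<le> P q"
    using tangent_lorentz(1)[OF qh gr_tangent[OF q]] by simp
  with * show "(hyp_norm (hyp_grad u q))\<^sup>2 = P q"
    by (simp add: hyp_grad_eq_gr[OF q] hyp_norm_def)
qed

text \<open>The gradient scales with degree -1, and the factor \<open>- lorentz x x\<close> in
  \<open>P\<close> compensates its square.\<close>

lemma P_scale:
  assumes x: "x \<in> open_ray_cone \<Omega>" and \<rho>: "\<rho> > 0"
  shows "P (\<rho> *\<^sub>R x) = P x"
proof -
  have xf: "x \<in> future_cone"
    using x \<Omega>_subset(1) by (auto simp: open_ray_cone_eq)
  have \<rho>x: "\<rho> *\<^sub>R x \<in> open_ray_cone \<Omega>"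
    using x \<rho> \<Omega>_subset(1) by (auto simp: open_ray_cone_eq future_cone_scale hyp_proj_scale)
  have "((\<lambda>y. \<rho> *\<^sub>R y) has_derivative (\<lambda>v. \<rho> *\<^sub>R v)) (at x)"
    by (intro has_derivative_scaleR_right has_derivative_ident)
  from has_derivative_compose[OF this U_deriv[OF \<rho>x]]
  have "((\<lambda>y. cone_ext u (\<rho> *\<^sub>R y)) has_derivative (\<lambda>v. lorentz (gr (\<rho> *\<^sub>R x)) (\<rho> *\<^sub>R v))) (at x)" .
  then have "(cone_ext u has_derivative (\<lambda>v. lorentz (gr (\<rho> *\<^sub>R x)) (\<rho> *\<^sub>R v))) (at x)"
    by (rule has_derivative_transform_within_open[OF _ open_future_cone xf]) (simp add: cone_ext_scale \<rho>)
  then have *: "(\<lambda>v. lorentz (gr (\<rho> *\<^sub>R x)) (\<rho> *\<^sub>R v)) = lorentz (gr x)"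
    by (rule has_derivative_unique) (rule U_deriv[OF x])
  have "lorentz (\<rho> *\<^sub>R gr (\<rho> *\<^sub>R x) - gr x) v = 0" for v
    using fun_cong[OF *, of v] by (simp add: lorentz.diff_left lorentz.scaleR_left lorentz.scaleR_right)
  then have "\<rho> *\<^sub>R gr (\<rho> *\<^sub>R x) - gr x = 0"
    by (rule lorentz_nondegenerate)
  then have "gr x = \<rho> *\<^sub>R gr (\<rho> *\<^sub>R x)"
    by simp
  then have "lorentz (gr x) (gr x) = \<rho> * (\<rho> * lorentz (gr (\<rho> *\<^sub>R x)) (gr (\<rho> *\<^sub>R x)))"
    by (simp only: lorentz.scaleR_left lorentz.scaleR_right real_scaleR_def)
  then show ?thesis
    by (simp add: P_def lorentz.scaleR_left lorentz.scaleR_right algebra_simps)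
qed

lemma sqrt_deriv:
  assumes q: "q \<in> \<Omega>" and P1: "P q < 1"
  shows "((\<lambda>x. sqrt (1 - P x)) has_derivative (\<lambda>v. - dP q v / (2 * sqrt (1 - P q)))) (at q)"
proof -
  have "((\<lambda>x. 1 - P x) has_derivative (\<lambda>v. 0 - dP q v)) (at q)"
    using q \<Omega>_subset(2) by (intro has_derivative_diff has_derivative_const P_deriv) auto
  from has_derivative_compose[OF this DERIV_real_sqrt[unfolded has_field_derivative_def]] show ?thesis
    using P1 by (simp add: field_simps)
qed

lemma hyp_div_eq:
  assumes q: "q \<in> \<Omega>" and P1: "\<And>x. x \<in> \<Omega> \<Longrightarrow> P x < 1"
  defines "s \<equiv> sqrt (1 - P q)"
  shows "s ^ 3 * hyp_div (\<lambda>p. (1 / sqrt (1 - (hyp_norm (hyp_grad u p))\<^sup>2)) *\<^sub>R hyp_grad u p) q = Q q"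
proof -
  have qS: "q \<in> open_ray_cone \<Omega>"
    using q \<Omega>_subset(2) by auto
  have s: "s > 0" "s\<^sup>2 = 1 - P q"
    using P1[OF q] by (auto simp: s_def)
  \<comment> \<open>Product rule for \<open>gr / sqrt (1 - P)\<close>; multiplication by
    \<open>s ^ 3\<close> will clear both denominators.\<close>
  define L where "L v = (1 / s) *\<^sub>R A q v + (dP q v / (2 * s ^ 3)) *\<^sub>R gr q" for v
  have "((\<lambda>x. inverse (sqrt (1 - P x))) has_derivative
      (\<lambda>v. - (inverse s * (- dP q v / (2 * s)) * inverse s))) (at q)"
    unfolding s_def by (rule Deriv.has_derivative_inverse[OF _ sqrt_deriv[OF q P1[OF q]]]) (use s in \<open>simp add: s_def\<close>)
  then have "((\<lambda>x. 1 / sqrt (1 - P x)) has_derivative (\<lambda>v. dP q v / (2 * s ^ 3))) (at q)"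
    using s by (simp add: field_simps power3_eq_cube)
  then have L: "((\<lambda>x. (1 / sqrt (1 - P x)) *\<^sub>R gr x) has_derivative L) (at q)"
    unfolding L_def s_def by (intro has_derivative_scaleR gr_deriv qS)
  have "hyp_div (\<lambda>p. (1 / sqrt (1 - (hyp_norm (hyp_grad u p))\<^sup>2)) *\<^sub>R hyp_grad u p) q = op_trace L"
    by (rule hyp_div_eq_trace[OF openin_\<Omega> q open_S qS L])
       (simp_all add: lorentz.scaleR_left radial P_eq(3)[symmetric] hyp_grad_eq_gr)
  also have "op_trace L = op_trace (A q) / s + dP q (gr q) / (2 * s ^ 3)"
  proof -
    have lin: "linear (dP q)"
      using P_deriv[OF qS] has_derivative_linear by blast
    have "(\<Sum>b\<in>Basis. dP q b * (gr q \<bullet> b)) = dP q (\<Sum>b\<in>Basis. (gr q \<bullet> b) *\<^sub>R b)"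
      by (simp add: linear_sum[OF lin] linear_cmul[OF lin] mult.commute)
    then have *: "(\<Sum>b\<in>Basis. dP q b * (gr q \<bullet> b)) = dP q (gr q)"
      by (simp only: euclidean_representation)
    have "op_trace L = (\<Sum>b\<in>Basis. lorentz (A q b) (flip_time b)) / s + (\<Sum>b\<in>Basis. dP q b * (gr q \<bullet> b)) / (2 * s ^ 3)"
      by (simp add: op_trace_def L_def lorentz_flip_time inner_add_left sum.distrib
          sum_divide_distrib)
    then show ?thesis
      by (simp only: * op_trace_def)
  qed
  also have "s ^ 3 * \<dots> = s\<^sup>2 * op_trace (A q) + dP q (gr q) / 2"
    using s(1) by (simp add: field_simps power2_eq_square power3_eq_cube)
  also have "\<dots> = Q q"
  proof -
    have "lorentz q q = -1" "lorentz q (gr q) = 0"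
      using q \<Omega>_subset(1) gr_tangent[OF q] by (auto simp: lorentz_hyp_space hyp_tangent_def)
    then show ?thesis
      by (simp add: Q_def dP_def s)
  qed
  finally show ?thesis
    by simp
qed

end

text \<open>The terms of order \<open>s\<^sup>2\<close> of the two summands containing \<open>R\<close> and its derivative cancel, so that
  after division by \<open>s\<^sup>2\<close> the term \<open>p\<close> is of order \<open>s\<close>.\<close>

lemma gradient_bound_arith:
  fixes s p \<phi> n t h d :: real
  assumes s: "0 < s" "s\<^sup>2 = 1 - p" and p: "0 \<le> p" and t: "0 \<le> t" "t \<le> 1" and n: "n \<ge> 0"
    and bounds: "\<bar>\<phi>\<bar> \<le> \<Phi>" "\<bar>h\<bar> \<le> h0" "\<bar>d\<bar> \<le> d0"
    and R: "R = n * t * (s\<^sup>2 - s ^ 3 * h)"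
    and R': "R' = n * t * (2 * \<phi> * s\<^sup>2 * p - 3 * s * \<phi> * s\<^sup>2 * p * h - s ^ 3 * d)"
    and ineq: "2 * s\<^sup>2 * p + 2 * \<phi>\<^sup>2 * (s\<^sup>2)\<^sup>2 * p + 2 * \<phi> * s\<^sup>2 * R - 4 * \<phi> * p * R + 2 * R' \<le> 0"
  shows "s \<ge> 1 / (1 + n * (2 * \<Phi> * h0 + d0 + \<Phi>))"
proof -
  define K where "K = n * (2 * \<Phi> * h0 + d0 + \<Phi>)"
  have nn: "0 \<le> \<Phi>" "0 \<le> h0" "0 \<le> d0"
    using bounds by linarith+
  have K: "K \<ge> 0"
    using n nn by (simp add: K_def)
  have s1: "s \<le> 1" "p \<le> 1"
    using s p abs_square_le_1[of s] zero_le_power2[of s] by auto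
  \<comment> \<open>What is left after the terms \<open>4 * n * t * \<phi> * p * s\<^sup>2\<close>
    of \<open>- 4 * \<phi> * p * R\<close> and \<open>2 * R'\<close> cancel and
    \<open>- 2 * n * t * s ^ 3\<close> is factored out.\<close>
  define e where "e = \<phi> * p * h + d - \<phi> * (s - s\<^sup>2 * h)"
  have "2 * \<phi> * s\<^sup>2 * R - 4 * \<phi> * p * R + 2 * R' = - (2 * n * t * s ^ 3 * e)"
    unfolding R R' e_def by (simp add: algebra_simps power2_eq_square power3_eq_cube)
  moreover have "0 \<le> 2 * \<phi>\<^sup>2 * (s\<^sup>2)\<^sup>2 * p"
    using p by simp
  ultimately have "2 * s\<^sup>2 * p \<le> 2 * n * t * s ^ 3 * e"
    using ineq by linarith
  then have "s\<^sup>2 * p \<le> s\<^sup>2 * (n * t * s * e)"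
    by (simp add: power2_eq_square power3_eq_cube mult_ac)
  then have "p \<le> n * t * s * e"
    using s(1) by (simp add: mult_le_cancel_left)
  also have "\<dots> \<le> n * t * s * (2 * \<Phi> * h0 + d0 + \<Phi>)"
  proof (rule mult_left_mono)
    have "\<bar>\<phi> * p * h\<bar> \<le> \<Phi> * 1 * h0"
      unfolding abs_mult using bounds p s1 by (intro mult_mono) auto
    moreover have "\<bar>\<phi> * s\<bar> \<le> \<Phi> * 1"
      unfolding abs_mult using bounds s s1 by (intro mult_mono) auto
    moreover have "\<bar>\<phi> * s\<^sup>2 * h\<bar> \<le> \<Phi> * 1 * h0"
      unfolding abs_mult using bounds p s s1 by (intro mult_mono) auto
    ultimately show "e \<le> 2 * \<Phi> * h0 + d0 + \<Phi>"
      using bounds(3) unfolding e_def by (simp add: algebra_simps abs_le_iff)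
  qed (use n t s in simp)
  also have "\<dots> \<le> n * 1 * s * (2 * \<Phi> * h0 + d0 + \<Phi>)"
    using n t s nn by (intro mult_right_mono mult_left_mono) auto
  finally have "p \<le> K * s"
    by (simp add: K_def mult_ac)
  \<comment> \<open>Together with \<open>p \<le> K * s\<close>, the identity
    \<open>s\<^sup>2 + p = 1\<close> yields the lower bound for \<open>s\<close>.\<close>
  moreover have "s\<^sup>2 \<le> s"
    unfolding power2_eq_square using s(1) s1(1) by (simp add: mult_left_le)
  ultimately have "1 \<le> s * (1 + K)"
    using s by (simp add: algebra_simps)
  then show ?thesis
    using K unfolding K_def[symmetric] by (simp add: divide_le_eq)
qed

section \<open>Continuous extension to the closure\<close>

text \<open>The strict condition on the time component can be relaxed, since it cannot vanish when
  \<open>lorentz x x = -1\<close>.\<close>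

lemma closed_hyp_space: "closed (hyp_space :: ('n::finite) mink set)"
proof -
  have "(hyp_space :: 'n mink set) = {x. lorentz x x = -1} \<inter> {x. snd x \<ge> 0}"
  proof (intro equalityI subsetI)
    fix x :: "'n mink" assume x: "x \<in> {x. lorentz x x = -1} \<inter> {x. snd x \<ge> 0}"
    have "snd x \<noteq> 0"
    proof
      assume "snd x = 0"
      then have "fst x \<bullet> fst x = -1"
        using x by (simp add: lorentz_def)
      then show False
        using inner_ge_zero[of "fst x"] by linarith
    qed
    with x show "x \<in> hyp_space"
      by (auto simp: hyp_space_def)
  qed (auto simp: hyp_space_def)
  moreover have "closed ({x::'n mink. lorentz x x = -1} \<inter> {x. snd x \<ge> 0})"
    by (intro closed_Int closed_Collect_eq closed_Collect_le continuous_intros)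
  ultimately show ?thesis
    by metis
qed

text \<open>For fixed \<open>p\<close>, the quantity \<open>- lorentz p q\<close> is at least
  \<open>snd p - norm (fst p) > 0\<close> times \<open>snd q\<close>, so the hyperbolic cosine of
  the distance controls the Euclidean size of \<open>q\<close>.\<close>

lemma hyp_bounded_imp_bounded:
  assumes \<Omega>: "\<Omega> \<subseteq> hyp_space" and bdd: "hyp_bounded \<Omega>"
  shows "bounded (\<Omega> :: ('n::finite) mink set)"
proof (cases "\<Omega> = {}")
  case False
  then obtain p where p: "p \<in> \<Omega>" by blast
  obtain R where R: "\<And>p q. p \<in> \<Omega> \<Longrightarrow> q \<in> \<Omega> \<Longrightarrow> hyp_dist p q \<le> R"
    using bdd by (auto simp: hyp_bounded_def)
  have lt: "norm (fst q) < snd q" if "q \<in> \<Omega>" for q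
  proof (rule power2_less_imp_less)
    have "fst q \<bullet> fst q - snd q * snd q = -1" "0 < snd q"
      using that \<Omega> by (auto simp: hyp_space_def lorentz_def)
    then show "(norm (fst q))\<^sup>2 < (snd q)\<^sup>2" "0 \<le> snd q"
      unfolding power2_norm_eq_inner power2_eq_square[of "snd q"] by linarith+
  qed
  define k where "k = snd p - norm (fst p)"
  have k: "k > 0"
    using lt[OF p] by (simp add: k_def)
  have "norm q \<le> 2 * (cosh R / k)" if q: "q \<in> \<Omega>" for q
  proof -
    have "- lorentz p q \<le> cosh R"
    \<comment> \<open>\<open>arcosh\<close> inverts \<open>cosh\<close> only from 1 on; below 1 the
      bound is trivial.\<close>
    proof (cases "- lorentz p q \<ge> 1")
      case True
      then have "- lorentz p q = cosh (hyp_dist p q)" "0 \<le> hyp_dist p q"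
        by (simp_all add: hyp_dist_def cosh_arcosh_real arcosh_nonneg_real)
      then show ?thesis
        using R[OF p q] by (simp add: cosh_real_nonneg_le_iff)
    next
      case False
      then show ?thesis
        using cosh_real_ge_1[of R] by linarith
    qed
    moreover have "fst p \<bullet> fst q \<le> norm (fst p) * snd q"
      using norm_cauchy_schwarz[of "fst p" "fst q"] mult_left_mono[of "norm (fst q)" "snd q" "norm (fst p)"]
        lt[OF q] by simp
    ultimately have "k * snd q \<le> cosh R"
      by (simp add: lorentz_def k_def algebra_simps)
    then have "snd q \<le> cosh R / k"
      using k by (simp add: field_simps)
    moreover have "norm q \<le> norm (fst q) + norm (snd q)"
      using norm_Pair_le[of "fst q" "snd q"] by simp
    moreover have "norm (snd q) = snd q"
      using lt[OF q] norm_ge_zero[of "fst q"] unfolding real_norm_def by linarith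
    ultimately show ?thesis
      using lt[OF q] by linarith
  qed
  then show ?thesis
    unfolding bounded_iff by blast
qed simp

lemma hyp_closure_eq:
  assumes "\<Omega> \<subseteq> hyp_space"
  shows "hyp_closure \<Omega> = closure \<Omega>"
proof -
  have "hyp_closure \<Omega> = hyp_space \<inter> closure \<Omega>"
    using assms by (simp add: closure_of_subtopology Int_absorb1)
  moreover have "closure \<Omega> \<subseteq> hyp_space"
    by (rule closure_minimal[OF assms closed_hyp_space])
  ultimately show ?thesis by blast
qed

lemma hyp_boundary_eq:
  assumes "openin (top_of_set hyp_space) \<Omega>"
  shows "hyp_boundary \<Omega> = hyp_closure \<Omega> - \<Omega>"
  using assms by (simp add: frontier_of_def interior_of_openin)

text \<open>The gradient is a continuous expression in the first chart derivatives, which extend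
  continuously to the closure.\<close>

lemma hyp_grad_continuous_extension:
  fixes u :: "('n::finite) mink \<Rightarrow> real"
  assumes \<Omega>: "openin (top_of_set hyp_space) \<Omega>" and u: "hyp_Ck_closure (Suc k) \<Omega> u"
  obtains W where "continuous_on (hyp_closure \<Omega>) W" "\<And>q. q \<in> \<Omega> \<Longrightarrow> W q = hyp_grad u q"
    "\<And>q. q \<in> hyp_closure \<Omega> \<Longrightarrow> hyp_grad_closure \<Omega> u q = W q"
proof -
  have sub: "\<Omega> \<subseteq> hyp_space"
    using \<Omega> openin_imp_subset by blast
  define f where "f = (\<lambda>y. u (hyp_param y))"
  define f' where "f' b = (\<lambda>y. frechet_derivative f (at y) b)" for b
  have f: "f differentiable (at y)" if "y \<in> fst ` \<Omega>" for y
    using u that by (auto simp: hyp_Ck_closure_def f_def[symmetric])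
  have "Ck_ext k (fst ` \<Omega>) (fst ` hyp_closure \<Omega>) (f' b)" if "b \<in> Basis" for b
    using u that by (auto simp: hyp_Ck_closure_def f_def[symmetric] f'_def)
  then have "\<exists>F. continuous_on (fst ` hyp_closure \<Omega>) F \<and> (\<forall>y\<in>fst ` \<Omega>. F y = f' b y)"
    if "b \<in> Basis" for b
    using that by (cases k) auto
  then obtain F where F: "\<And>b. b \<in> Basis \<Longrightarrow> continuous_on (fst ` hyp_closure \<Omega>) (F b)"
      "\<And>b y. b \<in> Basis \<Longrightarrow> y \<in> fst ` \<Omega> \<Longrightarrow> F b y = f' b y"
    by metis
  define W where "W q = grad_coord (fst q) (\<Sum>b\<in>Basis. F b (fst q) *\<^sub>R b)" for q :: "'n mink"
  have W1: "continuous_on (hyp_closure \<Omega>) W"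
  proof -
    have Fc: "continuous_on (hyp_closure \<Omega>) (\<lambda>q. F b (fst q))" if "b \<in> Basis" for b
      by (rule continuous_on_compose2[OF F(1)[OF that]]) (auto intro: continuous_intros)
    show ?thesis
      unfolding W_def grad_coord_def by (intro continuous_intros Fc)
  qed
  have W2: "W q = hyp_grad u q" if q: "q \<in> \<Omega>" for q
  proof -
    have fq: "(f has_derivative frechet_derivative f (at (fst q))) (at (fst q))"
      using f q frechet_derivative_works by blast
    have "frechet_derivative f (at (fst q)) h = (\<Sum>b\<in>Basis. F b (fst q) *\<^sub>R b) \<bullet> h" for h
    proof -
      note lin = has_derivative_linear[OF fq]
      have "frechet_derivative f (at (fst q)) h = frechet_derivative f (at (fst q)) (\<Sum>b\<in>Basis. (h \<bullet> b) *\<^sub>R b)"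
        by (simp only: euclidean_representation)
      also have "\<dots> = (\<Sum>b\<in>Basis. (h \<bullet> b) * F b (fst q))"
        using F(2) q by (simp add: linear_sum[OF lin] linear_cmul[OF lin] f'_def)
      finally show ?thesis
        by (simp add: inner_sum_left inner_commute[of h] mult.commute)
    qed
    then have "((\<lambda>y. u (hyp_param y)) has_derivative (\<lambda>h. (\<Sum>b\<in>Basis. F b (fst q) *\<^sub>R b) \<bullet> h)) (at (fst q))"
      using fq unfolding f_def[symmetric] by (intro has_derivative_eq_rhs[OF fq]) auto
    then show ?thesis
      unfolding W_def using q sub by (intro hyp_grad_coord[symmetric]) auto
  qed
  have "hyp_grad_closure \<Omega> u q = W q" if q: "q \<in> hyp_closure \<Omega>" for q
  proof (cases "q \<in> \<Omega>")
    case True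
    then show ?thesis
      by (simp add: hyp_grad_closure_def W2)
  next
    case False
    have "q islimpt \<Omega>"
      using q False sub by (auto simp: hyp_closure_eq closure_def)
    \<comment> \<open>A nontrivial filter makes limits unique, so that \<open>Lim\<close> returns
      \<open>W q\<close>.\<close>
    then have nb: "at q within \<Omega> \<noteq> bot"
      by (simp add: trivial_limit_within)
    have "(W \<longlongrightarrow> W q) (at q within \<Omega>)"
      using W1 q sub closure_subset[of \<Omega>]
      by (auto simp: continuous_on_def hyp_closure_eq intro: tendsto_within_subset)
    then have "(hyp_grad u \<longlongrightarrow> W q) (at q within \<Omega>)"
      by (rule Lim_transform_eventually) (auto simp: eventually_at_filter W2)
    with nb False show ?thesis
      by (simp add: hyp_grad_closure_def tendsto_Lim)
  qed
  with W1 W2 show thesis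
    by (intro that) auto
qed

text \<open>The relevant points fill the compact image \<open>K\<close>, which stays away from the
  vertex since \<open>r1 > 0\<close>. On the part of \<open>K\<close> over the boundary,
  \<open>H\<close> need not be differentiable; the derivative is bounded through its continuous
  extension \<open>F\<close> and the bound is used only over \<Omega>.\<close>

lemma cone_C1_bounds:
  fixes \<Omega> :: "('n::finite) mink set"
  assumes \<Omega>: "\<Omega> \<subseteq> hyp_space" "bounded \<Omega>"
    and H: "cone_Ck_closure 1 \<Omega> H" and r: "0 < r1"
  obtains h M where
    "\<And>q \<rho>. q \<in> \<Omega> \<Longrightarrow> r1 \<le> \<rho> \<Longrightarrow> \<rho> \<le> r2 \<Longrightarrow> \<bar>H (\<rho> *\<^sub>R q)\<bar> \<le> h"
    "\<And>q \<rho>. q \<in> \<Omega> \<Longrightarrow> r1 \<le> \<rho> \<Longrightarrow> \<rho> \<le> r2 \<Longrightarrow>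
      \<exists>H'. (H has_derivative H') (at (\<rho> *\<^sub>R q)) \<and> (\<forall>v. \<bar>H' v\<bar> \<le> M * norm v)"
proof -
  define C where "C = open_ray_cone (hyp_closure \<Omega>)"
  define K where "K = (\<lambda>(\<rho>, q). \<rho> *\<^sub>R q) ` ({r1..r2} \<times> hyp_closure \<Omega>)"
  have cl: "hyp_closure \<Omega> = closure \<Omega>"
    by (rule hyp_closure_eq[OF \<Omega>(1)])
  have "compact K"
    unfolding K_def cl using \<Omega>(2)
    by (intro compact_continuous_image compact_Times compact_Icc)
       (auto simp: case_prod_unfold compact_closure intro!: continuous_intros)
  have "K \<subseteq> C"
    using r by (fastforce simp: K_def C_def open_ray_cone_def)
  have bnd: "\<exists>B. \<forall>x\<in>K. \<bar>F x\<bar> \<le> B" if "continuous_on C F" for F :: "'n mink \<Rightarrow> real"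
  proof -
    have "compact (F ` K)"
      using continuous_on_subset[OF that \<open>K \<subseteq> C\<close>] \<open>compact K\<close> by (rule compact_continuous_image)
    then show ?thesis
      by (auto dest!: compact_imp_bounded simp: bounded_iff)
  qed
  obtain h where h: "\<And>x. x \<in> K \<Longrightarrow> \<bar>H x\<bar> \<le> h"
    using bnd[of H] H by (auto simp: cone_Ck_closure_def C_def)
  have diff: "H differentiable (at x)" if "x \<in> open_ray_cone \<Omega>" for x
    using H that by (auto simp: cone_Ck_closure_def)
  have "\<forall>b\<in>Basis. \<exists>B. \<forall>x\<in>K \<inter> open_ray_cone \<Omega>. \<bar>frechet_derivative H (at x) b\<bar> \<le> B"
  proof
    fix b :: "'n mink" assume "b \<in> Basis"
    then obtain F where F: "continuous_on C F" "\<And>x. x \<in> open_ray_cone \<Omega> \<Longrightarrow> F x = frechet_derivative H (at x) b"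
      using H by (auto simp: cone_Ck_closure_def C_def)
    then show "\<exists>B. \<forall>x\<in>K \<inter> open_ray_cone \<Omega>. \<bar>frechet_derivative H (at x) b\<bar> \<le> B"
      using bnd[OF F(1)] F(2) by (metis Int_iff)
  qed
  then obtain B where B: "\<And>b x. b \<in> Basis \<Longrightarrow> x \<in> K \<Longrightarrow> x \<in> open_ray_cone \<Omega> \<Longrightarrow>
      \<bar>frechet_derivative H (at x) b\<bar> \<le> B b"
    by (metis Int_iff)
  have inK: "\<rho> *\<^sub>R q \<in> K \<and> \<rho> *\<^sub>R q \<in> open_ray_cone \<Omega>" if "q \<in> \<Omega>" "r1 \<le> \<rho>" "\<rho> \<le> r2" for q \<rho>
  proof
    have "(\<rho>, q) \<in> {r1..r2} \<times> hyp_closure \<Omega>"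
      using that closure_subset[of \<Omega>] by (auto simp: cl)
    then show "\<rho> *\<^sub>R q \<in> K"
      unfolding K_def by (rule rev_image_eqI) simp
    show "\<rho> *\<^sub>R q \<in> open_ray_cone \<Omega>"
      using that r unfolding open_ray_cone_def by fastforce
  qed
  show thesis
  proof (rule that[of h "\<Sum>b\<in>Basis. B b"])
    show "\<bar>H (\<rho> *\<^sub>R q)\<bar> \<le> h" if "q \<in> \<Omega>" "r1 \<le> \<rho>" "\<rho> \<le> r2" for q \<rho>
      using h inK[OF that] by blast
    fix q \<rho> assume q: "q \<in> \<Omega>" "r1 \<le> \<rho>" "\<rho> \<le> r2"
    define x where "x = \<rho> *\<^sub>R q"
    have x: "x \<in> K" "x \<in> open_ray_cone \<Omega>"
      using inK[OF q] by (auto simp: x_def)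
    have D: "(H has_derivative frechet_derivative H (at x)) (at x)"
      using diff x frechet_derivative_works by blast
    have "\<bar>frechet_derivative H (at x) v\<bar> \<le> (\<Sum>b\<in>Basis. B b) * norm v" for v
    proof -
      note lin = has_derivative_linear[OF D]
      have "frechet_derivative H (at x) v = frechet_derivative H (at x) (\<Sum>b\<in>Basis. (v \<bullet> b) *\<^sub>R b)"
        by (simp only: euclidean_representation)
      also have "\<dots> = (\<Sum>b\<in>Basis. (v \<bullet> b) * frechet_derivative H (at x) b)"
        by (simp only: linear_sum[OF lin] linear_cmul[OF lin] real_scaleR_def)
      also have "\<bar>\<dots>\<bar> \<le> (\<Sum>b\<in>Basis. norm v * B b)"
      proof (rule order_trans[OF sum_abs], rule sum_mono)
        fix b :: "'n mink" assume "b \<in> Basis"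
        then show "\<bar>(v \<bullet> b) * frechet_derivative H (at x) b\<bar> \<le> norm v * B b"
          unfolding abs_mult using B x Basis_le_norm by (intro mult_mono) auto
      qed
      finally show ?thesis
        by (simp add: sum_distrib_left mult.commute)
    qed
    with D show "\<exists>H'. (H has_derivative H') (at (\<rho> *\<^sub>R q)) \<and> (\<forall>v. \<bar>H' v\<bar> \<le> (\<Sum>b\<in>Basis. B b) * norm v)"
      unfolding x_def[symmetric] by blast
  qed
qed

section \<open>The gradient bound\<close>

context hyp_C3
begin

text \<open>In the constant, \<open>n * \<Lambda>\<close> bounds \<open>n * u\<close>,
  \<open>r2 * h0\<close> bounds \<open>e^u H(e^u q)\<close>, and the middle group bounds the
  derivative of the latter along the gradient g: there \<open>H'\<close> is evaluated at
  \<open>e^u (g + P q)\<close>, with \<open>norm g \<le> 2 * b\<close> and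
  \<open>norm q \<le> b\<close>, whence \<open>3 * b\<close>.\<close>

lemma interior_minimum_bound:
  fixes t :: real and H :: "'n mink \<Rightarrow> real"
  defines "n \<equiv> real CARD('n)"
  assumes sol: "solves_dirichlet \<Omega> H t u" and t: "t \<in> {0..1}"
    and q: "q \<in> \<Omega>"
    and min: "\<And>x. x \<in> \<Omega> \<Longrightarrow> (1 - P q) * exp (- n * (u q)\<^sup>2) \<le> (1 - P x) * exp (- n * (u x)\<^sup>2)"
    and u: "\<bar>u q\<bar> \<le> \<Lambda>" "exp (u q) \<le> r2"
    and H: "\<bar>H (exp (u q) *\<^sub>R q)\<bar> \<le> h0"
    and H': "(H has_derivative H') (at (exp (u q) *\<^sub>R q))" "\<And>v. \<bar>H' v\<bar> \<le> M * norm v"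
    and b: "norm q \<le> b" and M: "M \<ge> 0"
  shows "sqrt (1 - P q) \<ge> 1 / (1 + n * (2 * (n * \<Lambda>) * (r2 * h0) + (r2 * h0 + r2 * (M * (r2 * (3 * b)))) + n * \<Lambda>))"
proof -
  have qh: "q \<in> hyp_space" and qS: "q \<in> open_ray_cone \<Omega>"
    using q \<Omega>_subset by auto
  have r2: "0 \<le> r2" "0 \<le> h0"
    using u(2) H exp_gt_zero[of "u q"] abs_ge_zero[of "H (exp (u q) *\<^sub>R q)"] by linarith+
  have P1: "P x < 1" if "x \<in> \<Omega>" for x
  proof -
    have "lorentz (hyp_grad u x) (hyp_grad u x) < 1"
      using sol that by (auto simp: solves_dirichlet_def hyp_norm_def)
    then show ?thesis
      using P_eq(1)[OF that] hyp_grad_eq_gr[OF that] by simp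
  qed
  define U where "U = cone_ext u"
  have Uq: "U x = u x" if "x \<in> \<Omega>" for x
    using that \<Omega>_subset by (auto simp: U_def cone_ext_hyp_space)
  define h where "h x = exp (U x) * H (exp (U x) *\<^sub>R x)" for x
  \<comment> \<open>Right-hand side of the equation multiplied by \<open>(1 - P) powr (3/2)\<close>,
    to match \<open>Q\<close>.\<close>
  define R where "R x = n * t * ((1 - P x) - sqrt (1 - P x) ^ 3 * h x)" for x
  define s where "s = sqrt (1 - P q)"
  have s: "0 < s" "s\<^sup>2 = 1 - P q"
    using P1[OF q] by (auto simp: s_def)
  define g where "g = gr q"
  have QR: "Q x = R x" if x: "x \<in> \<Omega>" for x
  proof -
    define \<sigma> D where "\<sigma> = sqrt (1 - P x)"
      and "D = hyp_div (\<lambda>p. (1 / sqrt (1 - (hyp_norm (hyp_grad u p))\<^sup>2)) *\<^sub>R hyp_grad u p) x"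
    have \<sigma>: "0 < \<sigma>" "\<sigma>\<^sup>2 = 1 - P x"
      using P1[OF x] by (auto simp: \<sigma>_def)
    have "- D + n * t / \<sigma> = n * t * exp (u x) * H (exp (u x) *\<^sub>R x)"
      unfolding D_def \<sigma>_def n_def P_eq(3)[OF x, symmetric]
      using sol x by (simp add: solves_dirichlet_def)
    then have "D = n * t / \<sigma> - n * t * h x"
      by (simp add: h_def Uq[OF x])
    then have "\<sigma> ^ 3 * D = \<sigma> ^ 3 * (n * t / \<sigma> - n * t * h x)"
      by simp
    also have "\<dots> = n * t * (\<sigma>\<^sup>2 - \<sigma> ^ 3 * h x)"
      using \<sigma>(1) by (simp add: field_simps power2_eq_square power3_eq_cube)
    finally have "\<sigma> ^ 3 * D = n * t * (\<sigma>\<^sup>2 - \<sigma> ^ 3 * h x)" .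
    moreover have "\<sigma> ^ 3 * D = Q x"
      unfolding \<sigma>_def D_def using hyp_div_eq[OF x P1] by blast
    ultimately show ?thesis
      by (simp add: R_def \<sigma> \<sigma>_def[symmetric])
  qed
  define h' where "h' v = exp (u q) * H' (exp (u q) *\<^sub>R v + (exp (u q) * lorentz g v) *\<^sub>R q)
      + (exp (u q) * lorentz g v) * H (exp (u q) *\<^sub>R q)" for v
  have h': "(h has_derivative h') (at q)"
  proof -
    have U: "(U has_derivative lorentz g) (at q)"
      unfolding U_def g_def by (rule U_deriv[OF qS])
    have e: "((\<lambda>x. exp (U x)) has_derivative (\<lambda>v. exp (u q) * lorentz g v)) (at q)"
      by (rule has_derivative_eq_rhs[OF has_derivative_exp[OF U]]) (simp add: Uq[OF q] mult.commute)
    have ex: "((\<lambda>x. exp (U x) *\<^sub>R x) has_derivative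
        (\<lambda>v. exp (u q) *\<^sub>R v + (exp (u q) * lorentz g v) *\<^sub>R q)) (at q)"
      using has_derivative_scaleR[OF e has_derivative_ident] by (simp add: Uq[OF q])
    have "((\<lambda>x. H (exp (U x) *\<^sub>R x)) has_derivative
        (\<lambda>v. H' (exp (u q) *\<^sub>R v + (exp (u q) * lorentz g v) *\<^sub>R q))) (at q)"
      by (rule has_derivative_compose[OF ex]) (use H'(1) in \<open>simp add: Uq[OF q]\<close>)
    from has_derivative_mult[OF e this] show ?thesis
      unfolding h_def h'_def by (simp add: Uq[OF q])
  qed
  define R' where "R' v = n * t * (- dP q v - (s ^ 3 * h' v + 3 * s\<^sup>2 * (- dP q v / (2 * s)) * h q))" for v
  have R': "(R has_derivative R') (at q)"
  proof -
    have 1: "((\<lambda>x. 1 - P x) has_derivative (\<lambda>v. - dP q v)) (at q)"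
      by (rule has_derivative_eq_rhs[OF has_derivative_diff[OF has_derivative_const P_deriv[OF qS]]]) simp
    have 2: "((\<lambda>x. sqrt (1 - P x) ^ 3) has_derivative (\<lambda>v. 3 * s\<^sup>2 * (- dP q v / (2 * s)))) (at q)"
      by (rule has_derivative_eq_rhs[OF has_derivative_power[OF sqrt_deriv[OF q P1[OF q]]]])
         (simp add: fun_eq_iff s_def)
    show ?thesis
      unfolding R_def R'_def
      by (rule has_derivative_eq_rhs[OF has_derivative_mult_right[OF has_derivative_diff[OF 1 has_derivative_mult[OF 2 h']]]])
         (simp add: s_def)
  qed
  define m where "m = (1 - P q) * exp (- n * (u q)\<^sup>2)"
  have m: "m * exp (n * (U q)\<^sup>2) = 1 - P q"
    by (simp add: m_def Uq[OF q] mult.assoc flip: exp_add)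
  \<comment> \<open>Minimality gives \<open>m * exp (n * u\<^sup>2) \<le> 1 - P\<close> on \<Omega>,
    with equality at \<open>q\<close>; constancy along rays carries this to the open cone.\<close>
  have max: "P x + m * exp (n * (U x)\<^sup>2) \<le> P q + m * exp (n * (U q)\<^sup>2)" if x: "x \<in> open_ray_cone \<Omega>" for x
  proof -
    obtain \<rho> p where p: "x = \<rho> *\<^sub>R p" "p \<in> \<Omega>" "\<rho> > 0"
      using x by (auto simp: open_ray_cone_def)
    have pf: "p \<in> future_cone" "p \<in> open_ray_cone \<Omega>"
      using p(2) \<Omega>_subset hyp_space_subset_future_cone by auto
    have "P x = P p" "U x = u p"
      using P_scale[OF pf(2) p(3)] cone_ext_scale[OF pf(1) p(3), of u] Uq[OF p(2)] by (auto simp: p(1) U_def)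
    moreover have "m * exp (n * (u p)\<^sup>2) \<le> (1 - P p) * exp (- n * (u p)\<^sup>2) * exp (n * (u p)\<^sup>2)"
      using min[OF p(2)] by (intro mult_right_mono) (auto simp: m_def)
    then have "m * exp (n * (u p)\<^sup>2) \<le> 1 - P p"
      by (simp add: mult.assoc flip: exp_add)
    ultimately show ?thesis
      using m by simp
  qed
  note max' = max[unfolded n_def U_def] and m' = m[unfolded n_def U_def]
  define \<phi> where "\<phi> = n * u q"
  have dPg: "dP q g = - (2 * \<phi> * s\<^sup>2) * P q"
    using interior_max_gradient[OF openin_\<Omega> q qS QR R' max' m' P1[OF q]]
    by (simp add: \<phi>_def Uq[OF q, unfolded U_def] g_def s P_eq(1)[OF q] n_def)
  have ineq: "2 * s\<^sup>2 * P q + 2 * \<phi>\<^sup>2 * (s\<^sup>2)\<^sup>2 * P q + 2 * \<phi> * s\<^sup>2 * R q - 4 * \<phi> * P q * R q + 2 * R' g \<le> 0"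
    using interior_max_inequality[OF openin_\<Omega> q qS QR R' max' m' P1[OF q]]
    unfolding \<phi>_def Uq[OF q, unfolded U_def] g_def s(2) n_def .
  show ?thesis
    unfolding s_def[symmetric]
  proof (rule gradient_bound_arith[OF s P_eq(2)[OF q] _ _ _ _ _ _ _ _ ineq])
    show "0 \<le> t" "t \<le> 1" "0 \<le> n"
      using t by (auto simp: n_def)
    show "\<bar>\<phi>\<bar> \<le> n * \<Lambda>"
      using u by (simp add: \<phi>_def abs_mult n_def mult_left_mono)
    show "\<bar>h q\<bar> \<le> r2 * h0"
      unfolding h_def abs_mult Uq[OF q] using u H r2 by (intro mult_mono) auto
    show "R q = n * t * (s\<^sup>2 - s ^ 3 * h q)"
      unfolding R_def s_def[symmetric] s(2) ..
    show "R' g = n * t * (2 * \<phi> * s\<^sup>2 * P q - 3 * s * \<phi> * s\<^sup>2 * P q * h q - s ^ 3 * h' g)"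
      unfolding R'_def dPg using s(1) by (simp add: field_simps power2_eq_square power3_eq_cube)
    have gg: "lorentz g g = P q"
      by (simp add: g_def P_eq(1)[OF q])
    have "(norm g)\<^sup>2 \<le> 2 * (snd q)\<^sup>2 * P q"
      using tangent_lorentz(2)[OF qh gr_tangent[OF q]] gg by (simp add: g_def)
    also have "\<dots> \<le> 2 * (snd q)\<^sup>2 * 1"
      using P1[OF q] by (intro mult_left_mono) auto
    also have "\<dots> \<le> (2 * \<bar>snd q\<bar>)\<^sup>2"
      by (simp add: power2_eq_square)
    finally have "norm g \<le> 2 * \<bar>snd q\<bar>"
      by (rule power2_le_imp_le) simp
    also have "\<bar>snd q\<bar> \<le> norm q"
      using norm_snd_le[of "snd q" "fst q"] by simp
    finally have ng: "norm g \<le> 2 * b"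
      using b by simp
    have P01: "0 \<le> P q" "P q \<le> 1"
      using P_eq(2)[OF q] P1[OF q] by auto
    define w where "w = exp (u q) *\<^sub>R g + (exp (u q) * P q) *\<^sub>R q"
    have "w = exp (u q) *\<^sub>R (g + P q *\<^sub>R q)"
      by (simp add: w_def scaleR_add_right)
    then have "norm w = exp (u q) * norm (g + P q *\<^sub>R q)"
      by simp
    also have "\<dots> \<le> r2 * (3 * b)"
    proof (intro mult_mono u)
      have "norm (g + P q *\<^sub>R q) \<le> norm g + P q * norm q"
        using norm_triangle_ineq[of g "P q *\<^sub>R q"] P01 by simp
      also have "P q * norm q \<le> 1 * b"
        using P01 b by (intro mult_mono) auto
      finally show "norm (g + P q *\<^sub>R q) \<le> 3 * b"
        using ng by simp
    qed (use r2 in auto)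
    finally have "M * norm w \<le> M * (r2 * (3 * b))"
      using M by (rule mult_left_mono)
    then have Hw: "\<bar>H' w\<bar> \<le> M * (r2 * (3 * b))"
      using H'(2)[of w] by linarith
    have "\<bar>h' g\<bar> \<le> \<bar>exp (u q) * H' w\<bar> + \<bar>(exp (u q) * P q) * H (exp (u q) *\<^sub>R q)\<bar>"
      unfolding h'_def gg w_def[symmetric] by (rule abs_triangle_ineq)
    also have "\<bar>exp (u q) * H' w\<bar> \<le> r2 * (M * (r2 * (3 * b)))"
      unfolding abs_mult using u Hw r2 by (intro mult_mono) auto
    also have "\<bar>(exp (u q) * P q) * H (exp (u q) *\<^sub>R q)\<bar> \<le> (r2 * 1) * h0"
      unfolding abs_mult using u H P01 r2 by (intro mult_mono) auto
    finally show "\<bar>h' g\<bar> \<le> r2 * h0 + r2 * (M * (r2 * (3 * b)))"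
      by simp
  qed
qed

end

theorem proposition8p1:
  fixes \<Omega> :: "('n::finite) mink set" and H :: "'n mink \<Rightarrow> real"
    and r1 r2 \<nu>0 :: real
  assumes "CARD('n) \<ge> 2"
    and "hyp_domain \<Omega>" and "hyp_bounded \<Omega>"
    and "cone_Ck_closure 1 \<Omega> H"
    and "r1 \<noteq> r2" and "0 < r1" and "r1 \<le> 1" and "1 \<le> r2"
    and "\<nu>0 > 0"
  shows "\<exists>C>0. \<forall>t\<in>{0..1}. \<forall>u.
           hyp_Ck_closure 3 \<Omega> u \<longrightarrow> solves_dirichlet \<Omega> H t u \<longrightarrow>
           (\<forall>q\<in>hyp_closure \<Omega>. ln r1 \<le> u q \<and> u q \<le> ln r2) \<longrightarrow>
           (SUP q\<in>hyp_boundary \<Omega>. nu \<Omega> u q) \<le> ennreal \<nu>0 \<longrightarrow>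
           (SUP q\<in>\<Omega>. nu \<Omega> u q) \<le> ennreal C"
proof -
  have \<Omega>: "openin (top_of_set hyp_space) \<Omega>" "\<Omega> \<noteq> {}"
    using assms(2) by (auto simp: hyp_domain_def)
  have sub: "\<Omega> \<subseteq> hyp_space"
    using \<Omega> openin_imp_subset by blast
  have bdd: "bounded \<Omega>"
    by (rule hyp_bounded_imp_bounded[OF sub assms(3)])
  have cl: "hyp_closure \<Omega> = closure \<Omega>"
    by (rule hyp_closure_eq[OF sub])
  have \<Omega>cl: "\<Omega> \<subseteq> hyp_closure \<Omega>"
    unfolding cl by (rule closure_subset)
  obtain b where b: "\<And>q. q \<in> \<Omega> \<Longrightarrow> norm q \<le> b"
    using bdd by (auto simp: bounded_iff)
  obtain h0 M where h0: "\<And>q \<rho>. q \<in> \<Omega> \<Longrightarrow> r1 \<le> \<rho> \<Longrightarrow> \<rho> \<le> r2 \<Longrightarrow> \<bar>H (\<rho> *\<^sub>R q)\<bar> \<le> h0"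
    and M: "\<And>q \<rho>. q \<in> \<Omega> \<Longrightarrow> r1 \<le> \<rho> \<Longrightarrow> \<rho> \<le> r2 \<Longrightarrow>
      \<exists>H'. (H has_derivative H') (at (\<rho> *\<^sub>R q)) \<and> (\<forall>v. \<bar>H' v\<bar> \<le> M * norm v)"
    using cone_C1_bounds[OF sub bdd assms(4,6), of r2] by blast
  define n where "n = real CARD('n)"
  define \<Lambda> where "\<Lambda> = max \<bar>ln r1\<bar> \<bar>ln r2\<bar>"
  \<comment> \<open>The absolute value of \<open>M\<close> is taken because the bound on the
    derivative of \<open>H\<close> comes without a sign for \<open>M\<close>.\<close>
  define K where "K = n * (2 * (n * \<Lambda>) * (r2 * h0) + (r2 * h0 + r2 * (\<bar>M\<bar> * (r2 * (3 * b)))) + n * \<Lambda>)"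
  have "0 \<le> b"
    using \<Omega>(2) b norm_ge_zero by (metis ex_in_conv order_trans)
  moreover have "0 \<le> h0"
    using \<Omega>(2) h0[of _ 1] assms(7,8) abs_ge_zero by (metis ex_in_conv order_trans)
  ultimately have K: "0 \<le> K"
    using assms(8) by (simp add: K_def n_def \<Lambda>_def)
  \<comment> \<open>Lower bound for \<open>sqrt (1 - |grad u|^2)\<close> at the minimum point: the
    first entry serves an interior point, the second a boundary point.\<close>
  define \<kappa> where "\<kappa> = min (1 / (1 + K)) (1 / \<nu>0)"
  have \<kappa>: "\<kappa> > 0"
    using K assms(9) by (simp add: \<kappa>_def)
  \<comment> \<open>Passing from the minimum point to any other point costs at most the factor
    \<open>exp (- n * \<Lambda>\<^sup>2)\<close>.\<close>
  define C where "C = 1 / sqrt (\<kappa>\<^sup>2 * exp (- n * \<Lambda>\<^sup>2))"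
  have "C > 0"
    using \<kappa> by (simp add: C_def)
  moreover have "(SUP q\<in>\<Omega>. nu \<Omega> u q) \<le> ennreal C"
    if t: "t \<in> {0..1}" and u: "hyp_Ck_closure 3 \<Omega> u" and sol: "solves_dirichlet \<Omega> H t u"
      and ur: "\<forall>q\<in>hyp_closure \<Omega>. ln r1 \<le> u q \<and> u q \<le> ln r2"
      and bd: "(SUP q\<in>hyp_boundary \<Omega>. nu \<Omega> u q) \<le> ennreal \<nu>0" for t u
  proof -
    have "Ck_on 3 (fst ` \<Omega>) (\<lambda>y. u (hyp_param y))"
      using u \<Omega>cl by (intro Ck_ext_imp_Ck_on[OF open_fst_image[OF \<Omega>(1)]]) (auto simp: hyp_Ck_closure_def)
    then obtain gr A B where "degree_zero_C3 (open_ray_cone \<Omega>) (cone_ext u) gr A B"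
      by (rule cone_ext_degree_zero_C3[OF \<Omega>(1)])
    then interpret hyp_C3 \<Omega> u gr A B
      by (intro hyp_C3.intro hyp_C3_axioms.intro \<Omega>)
    obtain W where W: "continuous_on (hyp_closure \<Omega>) W" "\<And>q. q \<in> \<Omega> \<Longrightarrow> W q = hyp_grad u q"
      "\<And>q. q \<in> hyp_closure \<Omega> \<Longrightarrow> hyp_grad_closure \<Omega> u q = W q"
      using hyp_grad_continuous_extension[OF \<Omega>(1), of 2 u] u by (metis numeral_3_eq_3 Suc_1 numeral_2_eq_2)
    \<comment> \<open>\<open>W\<close> replaces \<open>P\<close> here because it is continuous up to
      the boundary, where \<open>E\<close> might a priori vanish.\<close>
    define E where "E q = 1 - (hyp_norm (W q))\<^sup>2" for q
    define Z where "Z q = E q * exp (- n * (u q)\<^sup>2)" for q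
    have nuE: "nu \<Omega> u q = 1 / ennreal (sqrt (E q))" if "q \<in> hyp_closure \<Omega>" for q
      by (simp add: nu_def W(3)[OF that] E_def)
    have EP: "E q = 1 - P q" if "q \<in> \<Omega>" for q
      using W(2)[OF that] P_eq(3)[OF that] by (simp add: E_def)
    have E0: "0 < E q" if "q \<in> \<Omega>" for q
    proof -
      have "lorentz (gr q) (gr q) < 1"
        using sol that hyp_grad_eq_gr[OF that] by (auto simp: solves_dirichlet_def hyp_norm_def)
      then show ?thesis
        by (simp add: EP that P_eq(1))
    qed
    have u\<Lambda>: "\<bar>u q\<bar> \<le> \<Lambda>" "r1 \<le> exp (u q)" "exp (u q) \<le> r2" if "q \<in> hyp_closure \<Omega>" for q
    proof -
      have "ln r1 \<le> u q" "u q \<le> ln r2"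
        using ur that by auto
      moreover from this have "exp (ln r1) \<le> exp (u q)" "exp (u q) \<le> exp (ln r2)"
        by (simp_all only: exp_le_cancel_iff)
      ultimately show "\<bar>u q\<bar> \<le> \<Lambda>" "r1 \<le> exp (u q)" "exp (u q) \<le> r2"
        using assms(6,8) by (auto simp: \<Lambda>_def)
    qed
    have "continuous_on (hyp_closure \<Omega>) Z"
    proof -
      have "continuous_on (hyp_closure \<Omega>) u"
        using u by (simp add: hyp_Ck_closure_def)
      then show ?thesis
        unfolding Z_def E_def hyp_norm_def by (intro continuous_intros W(1))
    qed
    moreover have "compact (hyp_closure \<Omega>)" "hyp_closure \<Omega> \<noteq> {}"
      using bdd \<Omega> by (auto simp: cl compact_closure)
    ultimately obtain q where q: "q \<in> hyp_closure \<Omega>" "\<And>x. x \<in> hyp_closure \<Omega> \<Longrightarrow> Z q \<le> Z x"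
      using continuous_attains_inf by metis
    have E\<kappa>: "\<kappa> \<le> sqrt (E q)"
    proof (cases "q \<in> \<Omega>")
      case True
      obtain H' where H': "(H has_derivative H') (at (exp (u q) *\<^sub>R q))" "\<And>v. \<bar>H' v\<bar> \<le> M * norm v"
        using M[OF True u\<Lambda>(2,3)[OF q(1)]] by blast
      have "1 / (1 + K) \<le> sqrt (1 - P q)"
        unfolding K_def n_def
      proof (rule interior_minimum_bound[OF sol t True _ u\<Lambda>(1,3)[OF q(1)] h0[OF True u\<Lambda>(2,3)[OF q(1)]] H'(1) _ b[OF True]])
        show "(1 - P q) * exp (- real CARD('n) * (u q)\<^sup>2) \<le> (1 - P x) * exp (- real CARD('n) * (u x)\<^sup>2)"
          if "x \<in> \<Omega>" for x
          using q(2)[of x] that \<Omega>cl EP[OF that] EP[OF True] by (auto simp: Z_def n_def)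
        show "\<bar>H' v\<bar> \<le> \<bar>M\<bar> * norm v" for v
          using H'(2)[of v] mult_right_mono[OF abs_ge_self[of M] norm_ge_zero[of v]] by linarith
      qed simp
      then show ?thesis
        by (simp add: EP[OF True] \<kappa>_def)
    next
      case False
      then have "nu \<Omega> u q \<le> ennreal \<nu>0"
        using q(1) bd by (auto simp: hyp_boundary_eq[OF \<Omega>(1)] SUP_le_iff)
      then have *: "1 / ennreal (sqrt (E q)) \<le> ennreal \<nu>0"
        by (simp add: nuE[OF q(1)])
      \<comment> \<open>Otherwise the extended-valued quotient is infinite, against the finite bound
        \<open>\<nu>0\<close>.\<close>
      have pos: "sqrt (E q) > 0"
      proof (rule ccontr)
        assume "\<not> sqrt (E q) > 0"
        then have "ennreal (sqrt (E q)) = 0"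
          by (simp add: ennreal_neg)
        with * show False
          by (simp add: top_unique)
      qed
      then have "1 / ennreal (sqrt (E q)) = ennreal (1 / sqrt (E q))"
        by (metis divide_ennreal ennreal_1 zero_le_one)
      with * have "1 / sqrt (E q) \<le> \<nu>0"
        using assms(9) by (simp add: ennreal_le_iff)
      then have "1 / \<nu>0 \<le> sqrt (E q)"
        using pos assms(9) by (simp add: field_simps)
      then show ?thesis
        by (simp add: \<kappa>_def)
    qed
    have Eq: "\<kappa>\<^sup>2 \<le> E q"
      using E\<kappa> \<kappa> by (smt (verit) real_sqrt_ge_zero real_sqrt_le_0_iff real_sqrt_pow2 power_mono)
    have "nu \<Omega> u x \<le> ennreal C" if x: "x \<in> \<Omega>" for x
    proof -
      have xc: "x \<in> hyp_closure \<Omega>"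
        using x \<Omega>cl by auto
      have "(u q)\<^sup>2 \<le> \<Lambda>\<^sup>2"
        using u\<Lambda>(1)[OF q(1)] by (rule abs_le_square_iff[THEN iffD1, OF order_trans]) (simp add: \<Lambda>_def)
      then have "n * (u q)\<^sup>2 \<le> n * \<Lambda>\<^sup>2"
        by (simp add: n_def mult_left_mono)
      then have "\<kappa>\<^sup>2 * exp (- n * \<Lambda>\<^sup>2) \<le> E q * exp (- n * (u q)\<^sup>2)"
        using Eq by (intro mult_mono) (auto intro: order_trans[OF zero_le_power2])
      also have "\<dots> \<le> E x * exp (- n * (u x)\<^sup>2)"
        using q(2)[OF xc] by (simp add: Z_def)
      also have "\<dots> \<le> E x * 1"
        using E0[OF x] by (intro mult_left_mono) (auto simp: n_def)
      finally have "sqrt (\<kappa>\<^sup>2 * exp (- n * \<Lambda>\<^sup>2)) \<le> sqrt (E x)"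
        by simp
      then have "1 / sqrt (E x) \<le> C"
        unfolding C_def using \<kappa> by (intro divide_left_mono mult_pos_pos) (auto simp: E0[OF x])
      moreover have "nu \<Omega> u x = ennreal (1 / sqrt (E x))"
        unfolding nuE[OF xc] using E0[OF x] by (metis divide_ennreal ennreal_1 real_sqrt_gt_0_iff zero_le_one)
      ultimately show ?thesis
        by (simp add: ennreal_leI)
    qed
    then show ?thesis
      by (rule SUP_least)
  qed
  ultimately show ?thesis
    by blast
qed

end
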